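(* Let $\alpha>0$, $m\in(1,\infty]$, $n\ge2$, $s\ge1$, $L\ge2$ be parameters, $d=sn$, $w^*>0$. Consider $\boldsymbol W_{L:1}(t)=\boldsymbol W_L(t)\cdots\boldsymbol W_1(t)$ with factors $\boldsymbol W_l\in\mathbb R^{d\times d}$, each initialized as the matrix with diagonal entries $\alpha$ and off-diagonal entries $\alpha/m$ (with $\alpha/\infty=0$), evolving under the gradient flow of the squared loss on the block-diagonal observation set $\Omega_{\rm block}^{(s,n)}$ with all observed values equal to $w^*$. Then the limit $\boldsymbol W_{L:1}(\infty)$ has zero loss, $\ell(\boldsymbol W_{L:1}(\infty);\Omega_{\rm block}^{(s,n)})=0$, and its singular values $\sigma_1\ge\sigma_2\ge\cdots\ge\sigma_d$ satisfy $\sigma_j=0$ for all $j>n$. Moreover, for $i\in\{2,\dots,n\}$: - If $L=2$ (and $m<\infty$): $$\sigma_1=\frac{w^*d(m+d-1)^2}{(m+d-1)^2+(n-1)(m-1)^2},\qquad \sigma_i=\frac{w^*d(m-1)^2}{(m+d-1)^2+(n-1)(m-1)^2}.$$ - If $L\ge3$ and $1<m<\infty$, the singular values satisfy $$\sigma_1^{\frac{2-L}{L}}-\left(\frac{w^*d-\sigma_1}{n-1}\right)^{\frac{2-L}{L}}=C_{\alpha,m,L,d},\qquad \big(w^*d-(n-1)\sigma_i\big)^{\frac{2-L}{L}}-\sigma_i^{\frac{2-L}{L}}=C_{\alpha,m,L,d},$$ where $C_{\alpha,m,L,d}=\left(\frac{\alpha}{m}\right)^{2-L}\left((m+d-1)^{2-L}-(m-1)^{2-L}\right)$.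 - If $L\ge3$ and $m=\infty$: $\sigma_1=\sigma_i=sw^*$.
   Context: $\Omega_{\rm block}^{(s,n)}=\bigcup_{b=1}^n\{(i,j): i,j\in\{(b-1)s+1,\dots,bs\}\}$. The loss is $\ell(\boldsymbol W;\Omega)=\frac12\sum_{(i,j)\in\Omega}(W_{ij}-w^* )^2$, $\phi(\boldsymbol W_1,\dots,\boldsymbol W_L)=\ell(\boldsymbol W_L\cdots\boldsymbol W_1;\Omega_{\rm block}^{(s,n)})$, and gradient flow means $\dot{\boldsymbol W}_l(t)=-\partial\phi/\partial\boldsymbol W_l$ for all $l\in[L]$, $t\ge0$. $\boldsymbol W_{L:1}(\infty)=\lim_{t\to\infty}\boldsymbol W_{L:1}(t)$. *)

theory Defs
  imports
    "HOL-Analysis.Analysis"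
    "HOL-Library.Extended_Real"
    "Jordan_Normal_Form.Char_Poly"
begin

text \<open>Matrix rows and columns are indexed from 0, so the \<open>b\<close>-th block
  (\<open>b = 1, \<dots>, n\<close>) occupies the indices \<open>(b - 1) * s, \<dots>, b * s - 1\<close>.\<close>

definition Omega_block :: "nat \<Rightarrow> nat \<Rightarrow> (nat \<times> nat) set" where
  "Omega_block s n = (\<Union>b\<in>{1..n}. {(b - 1) * s ..< b * s} \<times> {(b - 1) * s ..< b * s})"

definition loss :: "real \<Rightarrow> (nat \<times> nat) set \<Rightarrow> real mat \<Rightarrow> real" where
  "loss w \<Omega> A = 1 / 2 * (\<Sum>ij\<in>\<Omega>. (A $$ ij - w)\<^sup>2)"

text \<open>\<open>factor_prod d L V\<close> is the \<open>d \<times> d\<close> matrix \<open>V L * \<dots> * V 1\<close>.\<close>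

primrec factor_prod :: "nat \<Rightarrow> nat \<Rightarrow> (nat \<Rightarrow> real mat) \<Rightarrow> real mat" where
  "factor_prod d 0 V = 1\<^sub>m d"
| "factor_prod d (Suc l) V = V (Suc l) * factor_prod d l V"

definition phi :: "real \<Rightarrow> nat \<Rightarrow> nat \<Rightarrow> nat \<Rightarrow> (nat \<Rightarrow> real mat) \<Rightarrow> real" where
  "phi w s n L V = loss w (Omega_block s n) (factor_prod (s * n) L V)"

text \<open>The partial derivative of \<open>F\<close> with respect to the \<open>ij\<close>-entry of the \<open>l\<close>-th factor,
  all other entries of all factors being held fixed.\<close>

definition partial_entry ::
    "((nat \<Rightarrow> real mat) \<Rightarrow> real) \<Rightarrow> (nat \<Rightarrow> real mat) \<Rightarrow> nat \<Rightarrow> nat \<times> nat \<Rightarrow> real" where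
  "partial_entry F V l ij = deriv (\<lambda>x. F (V(l := update_mat (V l) ij x))) (V l $$ ij)"

text \<open>The derivative at time 0 is one-sided.\<close>

definition gradient_flow ::
    "nat \<Rightarrow> nat \<Rightarrow> ((nat \<Rightarrow> real mat) \<Rightarrow> real) \<Rightarrow> (real \<Rightarrow> nat \<Rightarrow> real mat) \<Rightarrow> bool" where
  "gradient_flow d L F W \<longleftrightarrow>
    (\<forall>t\<ge>0. \<forall>l\<in>{1..L}. W t l \<in> carrier_mat d d \<and>
      (\<forall>i<d. \<forall>j<d. ((\<lambda>\<tau>. W \<tau> l $$ (i, j)) has_real_derivative
                       - partial_entry F (W t) l (i, j)) (at t within {0..})))"

text \<open>For \<open>m = \<infinity>\<close> the extended quotient \<open>ereal \<alpha> / m\<close> is 0.\<close>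

definition init_mat :: "nat \<Rightarrow> real \<Rightarrow> ereal \<Rightarrow> real mat" where
  "init_mat d \<alpha> m =
    mat d d (\<lambda>(i, j). if i = j then \<alpha> else real_of_ereal (ereal \<alpha> / m))"

definition mat_tendsto :: "(real \<Rightarrow> real mat) \<Rightarrow> real mat \<Rightarrow> bool" where
  "mat_tendsto A B \<longleftrightarrow>
    (\<forall>i<dim_row B. \<forall>j<dim_col B. ((\<lambda>t. A t $$ (i, j)) \<longlongrightarrow> B $$ (i, j)) at_top)"

text \<open>The singular values of a square real matrix \<open>A\<close>: the square roots of the eigenvalues of
  \<open>A\<^sup>T A\<close>, repeated according to algebraic multiplicity and listed in decreasing order. As
  \<open>A\<^sup>T A\<close> is symmetric and positive semidefinite, its characteristic polynomial splits over the
  reals with nonnegative roots, so the list has as many entries as \<open>A\<close> has columns.\<close>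

definition singular_values :: "real mat \<Rightarrow> real list" where
  "singular_values A =
    rev (sorted_list_of_multiset (image_mset sqrt (proots (char_poly (transpose_mat A * A)))))"

text \<open>\<open>sing_val A j\<close> is the \<open>j\<close>-th largest singular value, counting from \<open>j = 1\<close>.\<close>

definition sing_val :: "real mat \<Rightarrow> nat \<Rightarrow> real" where
  "sing_val A j = singular_values A ! (j - 1)"

definition C_const :: "real \<Rightarrow> real \<Rightarrow> nat \<Rightarrow> nat \<Rightarrow> real" where
  "C_const \<alpha> m L d = (\<alpha> / m) powi (2 - int L) *
     ((m + real d - 1) powi (2 - int L) - (m - 1) powi (2 - int L))"

end

theory Submission
  imports Defs
begin

text \<open>
  The set of factor families whose members all equal one matrix \<open>x E\<^sub>1 + y E\<^sub>2 + z E\<^sub>3\<close>, with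
  \<open>E\<^sub>1\<close>, \<open>E\<^sub>2\<close>, \<open>E\<^sub>3\<close> the projections attached to the block partition, contains the initial value
  and is invariant under the gradient field, so the flow stays in it. On it the flow reads
  \<open>x' = - r x^(L-1)\<close>, \<open>y' = - r y^(L-1)\<close>, \<open>z' = - z^(2L-1)\<close> with
  \<open>r = (x^L + (n-1) y^L) / n - s w\<close>. Thus \<open>z\<close> tends to \<open>0\<close>; and since \<open>r' = - q r\<close> with \<open>q\<close> bounded away
  from \<open>0\<close>, \<open>r\<close> decays exponentially while \<open>x\<close> and \<open>y\<close> are monotone and bounded, hence converge.
  The limits satisfy \<open>x^L + (n-1) y^L = w d\<close>, and a second equation comes from the conserved quantity
  \<open>x / y\<close> (if \<open>L = 2\<close>) or \<open>x^(2-L) - y^(2-L)\<close> (if \<open>L \<ge> 3\<close>). The limiting product has eigenvalues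
  \<open>x^L\<close> (once), \<open>y^L\<close> (\<open>n - 1\<close> times) and \<open>0\<close>.
\<close>

section \<open>The algebra of block-symmetric matrices\<close>

text \<open>Restriction to the diagonal blocks replaces \<open>E1\<close> by
  \<open>(E1 + E2) / n\<close>, fixes \<open>E1 + E2\<close> and \<open>E3\<close>, and turns the
  constant target matrix into \<open>s w (E1 + E2)\<close>. The observed residual therefore cannot
  tell \<open>E1\<close> from \<open>E2\<close>: it is \<open>r (E1 + E2) + z^L E3\<close>. This is
  why one function \<open>r\<close> drives both \<open>x\<close> and \<open>y\<close>, and
  eliminating time from the two equations yields the conserved quantity. For finite \<open>m\<close>
  the initial values are \<open>x = (\<alpha> / m) (m + d - 1)\<close> and
  \<open>y = (\<alpha> / m) (m - 1)\<close>, so for \<open>L \<ge> 3\<close> the constant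
  \<open>C_const\<close> is that quantity at time 0. Two degeneracies shape the limit argument. The
  loss has a critical point at the origin, so the decay of \<open>r\<close> rests on a lower bound
  for \<open>x\<close>. And \<open>y\<close> might a priori tend to 0, where the conserved quantity
  is singular; the conservation law is therefore passed to the limit with its denominators
  cleared.\<close>

lemma block_card:
  assumes "b < (n::nat)" "s \<ge> 1"
  shows "card {k. k < s * n \<and> k div s = b} = s"
proof -
  have "{k. k < s * n \<and> k div s = b} = {b * s..<Suc b * s}"
  proof (intro Set.set_eqI iffI)
    fix k assume "k \<in> {b * s..<Suc b * s}"
    then have k: "b * s \<le> k" "k < Suc b * s" by auto
    have "Suc b * s \<le> n * s" using assms by (intro mult_right_mono) auto
    moreover have "k div s = b" using k assms by (intro div_nat_eqI) (auto simp: algebra_simps)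
    ultimately show "k \<in> {k. k < s * n \<and> k div s = b}" using k by (auto simp: algebra_simps)
  next
    fix k assume "k \<in> {k. k < s * n \<and> k div s = b}"
    then have "k div s = b" by auto
    moreover have "k < s * Suc (k div s)" using assms(2)
      by (simp add: dividend_less_times_div)
    ultimately show "k \<in> {b * s..<Suc b * s}" by (auto simp: algebra_simps)
  qed
  then show ?thesis by simp
qed

lemma block_sum_const:
  fixes c :: real and s n b :: nat
  assumes "b < n" "s \<ge> 1"
  shows "(\<Sum>k<s * n. if k div s = b then c else 0) = s * c"
    and "(\<Sum>k<s * n. if b = k div s then c else 0) = s * c"
proof -
  have "(\<Sum>k<s * n. if k div s = b then c else 0) = (\<Sum>k\<in>{k\<in>{..<s * n}. k div s = b}. c)"
    by (rule sum.inter_filter[symmetric]) simp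
  also have "\<dots> = s * c" using block_card[OF assms] by simp
  finally show "(\<Sum>k<s * n. if k div s = b then c else 0) = s * c" .
  then show "(\<Sum>k<s * n. if b = k div s then c else 0) = s * c" by (simp add: eq_commute)
qed

lemma div_less_blocks: "k < s * n \<Longrightarrow> k div s < (n::nat)"
  by (simp add: less_mult_imp_div_less mult.commute)

lemma mat_mult_entry:
  fixes A B :: "real mat"
  assumes "A \<in> carrier_mat d d" "B \<in> carrier_mat d d" "i < d" "j < d"
  shows "(A * B) $$ (i, j) = (\<Sum>k<d. A $$ (i, k) * B $$ (k, j))"
  using assms by (auto simp: scalar_prod_def lessThan_atLeast0 intro!: sum.cong)

text \<open>\<open>bmat s n x y z\<close> is the matrix \<open>x E\<^sub>1 + y E\<^sub>2 + z E\<^sub>3\<close>, where \<open>E\<^sub>1\<close>, \<open>E\<^sub>2\<close>, \<open>E\<^sub>3\<close> are the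
  orthogonal projections onto the constant vectors, the block-constant vectors of sum zero, and the
  vectors of sum zero on each block. For \<open>s = 1\<close> the last space is trivial and \<open>z\<close> is irrelevant.\<close>

definition bmat :: "nat \<Rightarrow> nat \<Rightarrow> real \<Rightarrow> real \<Rightarrow> real \<Rightarrow> real mat" where
  "bmat s n x y z = mat (s * n) (s * n) (\<lambda>(i, j). (x - y) / (s * n)
     + (if i div s = j div s then (y - z) / s else 0) + (if i = j then z else 0))"

lemma bmat_carrier [simp]: "bmat s n x y z \<in> carrier_mat (s * n) (s * n)"
  by (simp add: bmat_def)

lemma bmat_index:
  "i < s * n \<Longrightarrow> j < s * n \<Longrightarrow> bmat s n x y z $$ (i, j) = (x - y) / (s * n)
     + (if i div s = j div s then (y - z) / s else 0) + (if i = j then z else 0)"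
  by (simp add: bmat_def)

lemma bmat_transpose [simp]: "transpose_mat (bmat s n x y z) = bmat s n x y z"
  by (rule eq_matI) (auto simp: bmat_def)

lemma bmat_one: "s \<ge> 1 \<Longrightarrow> bmat s n 1 1 1 = 1\<^sub>m (s * n)"
  by (rule eq_matI) (auto simp: bmat_def)

text \<open>The three projections are orthogonal idempotents, so their coefficients multiply
  separately. The computation passes to the coefficients \<open>u\<close>, \<open>v\<close>,
  \<open>z\<close> of the all-ones matrix, the block-ones matrix and the identity; the nine sums are
  the pairwise products of these.\<close>

lemma bmat_mult:
  assumes "s \<ge> 1" "n \<ge> 1"
  shows "bmat s n x y z * bmat s n x' y' z' = bmat s n (x * x') (y * y') (z * z')"
proof (rule eq_matI)
  fix i j
  assume "i < dim_row (bmat s n (x * x') (y * y') (z * z'))"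
    and "j < dim_col (bmat s n (x * x') (y * y') (z * z'))"
  then have ij: "i < s * n" "j < s * n" by (auto simp: bmat_def)
  note bl = div_less_blocks[OF ij(1)] div_less_blocks[OF ij(2)]
  define u u' v v' where "u = (x - y) / (s * n)" and "u' = (x' - y') / (s * n)"
    and "v = (y - z) / s" and "v' = (y' - z') / s"
  let ?B = "\<lambda>i j c. if i div s = j div s then c else (0::real)"
  let ?D = "\<lambda>i j c. if i = j then c else (0::real)"
  have "(bmat s n x y z * bmat s n x' y' z') $$ (i, j)
      = (\<Sum>k<s * n. (u + ?B i k v + ?D i k z) * (u' + ?B k j v' + ?D k j z'))"
    using ij by (simp add: mat_mult_entry[of _ "s * n"] bmat_index u_def u'_def v_def v'_def cong: if_cong)
  also have "\<dots> = (\<Sum>k<s * n. u * u' + ?B k j (u * v') + ?D k j (u * z')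
      + ?B i k (v * u') + (if i div s = j div s then ?B k j (v * v') else 0)
      + ?D k j (?B i j (v * z')) + ?D i k (z * u') + ?D i k (?B i j (z * v')) + ?D i k (?D i j (z * z')))"
    by (intro sum.cong refl) (auto simp: algebra_simps)
  also have "\<dots> = s * n * (u * u') + s * (u * v') + u * z' + s * (v * u')
      + (if i div s = j div s then s * (v * v') else 0) + ?B i j (v * z') + z * u'
      + ?B i j (z * v') + ?D i j (z * z')"
    using ij bl assms by (simp add: sum.distrib block_sum_const)
  also have "\<dots> = bmat s n (x * x') (y * y') (z * z') $$ (i, j)"
    using ij assms unfolding u_def u'_def v_def v'_def
    by (simp add: bmat_index divide_simps) (simp add: algebra_simps)
  finally show "(bmat s n x y z * bmat s n x' y' z') $$ (i, j)
      = bmat s n (x * x') (y * y') (z * z') $$ (i, j)" .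
qed (auto simp: bmat_def)

section \<open>Spectrum and singular values of block-symmetric matrices\<close>

lemma proots_prod_list_linear:
  "proots (\<Prod>a\<leftarrow>as. [:- a, 1:]) = mset (as :: real list)"
proof (induction as)
  case (Cons a as)
  have "(\<Prod>a\<leftarrow>as. [:- a, 1:]) \<noteq> 0" by (auto simp: prod_list_zero_iff)
  then have "proots ([:- a, 1:] * (\<Prod>a\<leftarrow>as. [:- a, 1:])) = {#a#} + mset as"
    using Cons by (subst proots_mult) simp_all
  then show ?case by (simp only: list.map prod_list.Cons mset.simps) simp
qed simp

lemma card_multiples_below:
  assumes "s \<ge> 1"
  shows "card {j. j < s * n \<and> s dvd j} = (n::nat)"
proof -
  have "{j. j < s * n \<and> s dvd j} = (\<lambda>b. s * b) ` {..<n}"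
    using assms by (auto simp: dvd_def)
  moreover have "inj_on (\<lambda>b. s * b) {..<n}" using assms by (auto simp: inj_on_def)
  ultimately show ?thesis by (simp add: card_image)
qed

text \<open>The first column is the all-ones vector, column \<open>b * s\<close> is the indicator of block \<open>b\<close>, and the
  remaining columns are differences of two unit vectors of the same block, which span the kernel
  of \<open>bmat s n x y 0\<close>.\<close>

definition eigbasis :: "nat \<Rightarrow> nat \<Rightarrow> real mat" where
  "eigbasis s n = mat (s * n) (s * n) (\<lambda>(i, j). if j = 0 then 1
     else if s dvd j then (if i div s = j div s then 1 else 0)
     else (if i = j then 1 else 0) - (if i = j div s * s then 1 else 0))"

text \<open>This is the operator written in the basis \<open>eigbasis\<close>. Block indicators are
  not eigenvectors: one is sent to \<open>y\<close> times itself plus \<open>(x - y) / n\<close>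
  times the all-ones vector, which fills the first row. A triangular form suffices to read off the
  characteristic polynomial.\<close>

definition eigtri :: "nat \<Rightarrow> nat \<Rightarrow> real \<Rightarrow> real \<Rightarrow> real mat" where
  "eigtri s n x y = mat (s * n) (s * n) (\<lambda>(i, j). if j = 0 then (if i = 0 then x else 0)
     else if s dvd j then (if i = j then y else 0) + (if i = 0 then (x - y) / n else 0) else 0)"

lemma bmat_eigbasis:
  assumes "s \<ge> 1" "n \<ge> 1"
  shows "bmat s n x y 0 * eigbasis s n = eigbasis s n * eigtri s n x y"
proof (rule eq_matI)
  fix i j
  assume "i < dim_row (eigbasis s n * eigtri s n x y)" "j < dim_col (eigbasis s n * eigtri s n x y)"
  then have ij: "i < s * n" "j < s * n" by (auto simp: eigbasis_def eigtri_def)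
  note bl = div_less_blocks[OF ij(1)] div_less_blocks[OF ij(2)]
  have j': "j div s * s < s * n" using bl(2) assms by (simp add: mult.commute)
  have c: "eigbasis s n \<in> carrier_mat (s * n) (s * n)" "eigtri s n x y \<in> carrier_mat (s * n) (s * n)"
    by (auto simp: eigbasis_def eigtri_def)
  define u v where "u = (x - y) / (s * n)" and "v = y / s"
  have L: "(bmat s n x y 0 * eigbasis s n) $$ (i, j)
    = (\<Sum>k<s * n. (u + (if i div s = k div s then v else 0)) * eigbasis s n $$ (k, j))"
    using ij c by (simp add: mat_mult_entry[of _ "s * n"] bmat_index u_def v_def cong: if_cong)
  have R: "(eigbasis s n * eigtri s n x y) $$ (i, j)
    = (\<Sum>k<s * n. eigbasis s n $$ (i, k) * eigtri s n x y $$ (k, j))"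
    using ij c by (intro mat_mult_entry)
  have pos: "0 < s * n" using assms by simp
  consider "j = 0" | "j \<noteq> 0" "s dvd j" | "j \<noteq> 0" "\<not> s dvd j" by blast
  then show "(bmat s n x y 0 * eigbasis s n) $$ (i, j) = (eigbasis s n * eigtri s n x y) $$ (i, j)"
  proof cases
    case 1
    have "(bmat s n x y 0 * eigbasis s n) $$ (i, j) = s * n * u + s * v"
      unfolding L using 1 pos bl assms
      by (simp add: eigbasis_def sum.distrib block_sum_const)
    also have "\<dots> = x" using assms by (simp add: u_def v_def)
    also have "x = (\<Sum>k<s * n. if k = 0 then x else 0)" using pos by simp
    also have "\<dots> = (eigbasis s n * eigtri s n x y) $$ (i, j)"
      unfolding R using 1 pos ij
      by (intro sum.cong refl) (simp add: eigbasis_def eigtri_def)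
    finally show ?thesis .
  next
    case 2
    have "(bmat s n x y 0 * eigbasis s n) $$ (i, j)
      = (\<Sum>k<s * n. (if k div s = j div s then u + (if i div s = j div s then v else 0) else 0))"
      unfolding L using 2 ij
      by (intro sum.cong refl) (simp add: eigbasis_def)
    also have "\<dots> = s * (u + (if i div s = j div s then v else 0))"
      using bl assms by (simp add: block_sum_const)
    also have "\<dots> = (x - y) / n + (if i div s = j div s then y else 0)"
      using assms by (simp add: u_def v_def field_simps)
    also have "\<dots> = (\<Sum>k<s * n. (if k = j then (if i div s = j div s then y else 0) else 0)
        + (if k = 0 then (x - y) / n else 0))"
      using pos ij by (simp add: sum.distrib)
    also have "\<dots> = (eigbasis s n * eigtri s n x y) $$ (i, j)"
      unfolding R using 2 pos ij
      by (intro sum.cong refl) (auto simp: eigbasis_def eigtri_def)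
    finally show ?thesis .
  next
    case 3
    have "(bmat s n x y 0 * eigbasis s n) $$ (i, j)
      = (\<Sum>k<s * n. (if k = j then u + (if i div s = j div s then v else 0) else 0)
         - (if k = j div s * s then u + (if i div s = j div s then v else 0) else 0))"
      unfolding L using 3 ij assms
      by (intro sum.cong refl) (auto simp: eigbasis_def)
    also have "\<dots> = 0" using ij j' by (simp add: sum_subtractf)
    also have "0 = (eigbasis s n * eigtri s n x y) $$ (i, j)"
      unfolding R using 3 ij by (simp add: eigtri_def)
    finally show ?thesis .
  qed
qed (auto simp: bmat_def eigbasis_def eigtri_def)

text \<open>Let \<open>v\<close> lie in the kernel. Adding the equations of the rows in block
  \<open>b\<close> cancels all difference columns and leaves \<open>v\<close> at 0 plus
  \<open>v\<close> at \<open>b * s\<close>, or only \<open>v\<close> at 0 if \<open>b = 0\<close>.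
  So \<open>v\<close> vanishes at 0, then at every multiple of \<open>s\<close>, and then row
  \<open>k\<close> for any other \<open>k\<close> reads off its entry at \<open>k\<close>.\<close>

lemma eigbasis_det:
  assumes "s \<ge> 1" "n \<ge> 1"
  shows "det (eigbasis s n) \<noteq> 0"
proof
  let ?P = "eigbasis s n"
  have c: "?P \<in> carrier_mat (s * n) (s * n)" by (simp add: eigbasis_def)
  assume "det ?P = 0"
  then obtain v where v: "v \<in> carrier_vec (s * n)" "v \<noteq> 0\<^sub>v (s * n)" "?P *\<^sub>v v = 0\<^sub>v (s * n)"
    using det_0_iff_vec_prod_zero[OF c] by blast
  have row: "(\<Sum>j<s * n. ?P $$ (k, j) * vec_index v j) = 0" if "k < s * n" for k
  proof -
    have "vec_index (?P *\<^sub>v v) k = (\<Sum>j<s * n. ?P $$ (k, j) * vec_index v j)"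
      using that v(1) c by (auto simp: scalar_prod_def lessThan_atLeast0 eigbasis_def intro!: sum.cong)
    then show ?thesis using v(3) that by simp
  qed
  have pos: "0 < s * n" using assms by simp
  have colsum: "(\<Sum>k<s * n. if k div s = b then ?P $$ (k, j) else 0)
      = (if j = 0 \<or> j = b * s then s else 0)" if "b < n" "j < s * n" for b j
  proof -
    have j': "j div s * s < s * n" "j div s * s div s = j div s"
      using div_less_blocks[OF that(2)] assms by (auto simp: mult.commute)
    consider "j = 0" | "j \<noteq> 0" "s dvd j" | "j \<noteq> 0" "\<not> s dvd j" by blast
    then show ?thesis
    proof cases
      case 1
      then have "(\<Sum>k<s * n. if k div s = b then ?P $$ (k, j) else 0)
        = (\<Sum>k<s * n. if k div s = b then 1 else 0)"
        using pos by (intro sum.cong refl) (simp add: eigbasis_def)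
      then show ?thesis using 1 block_sum_const[OF that(1) assms(1), of 1] by simp
    next
      case 2
      then have "(\<Sum>k<s * n. if k div s = b then ?P $$ (k, j) else 0)
        = (\<Sum>k<s * n. if k div s = b then (if j = b * s then 1 else 0) else 0)"
        using that assms by (intro sum.cong refl) (auto simp: eigbasis_def)
      then show ?thesis using 2 that assms by (simp add: block_sum_const)
    next
      case 3
      then have "(\<Sum>k<s * n. if k div s = b then ?P $$ (k, j) else 0)
        = (\<Sum>k<s * n. (if k = j then (if j div s = b then 1 else 0) else 0)
            - (if k = j div s * s then (if j div s = b then 1 else 0) else 0))"
        using that j' assms by (intro sum.cong refl) (auto simp: eigbasis_def)
      also have "\<dots> = 0" using that j' by (simp add: sum_subtractf)
      finally show ?thesis using 3 by auto
    qed
  qed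
  have blk: "(\<Sum>j<s * n. (if j = 0 \<or> j = b * s then s else 0) * vec_index v j) = 0" if "b < n" for b
  proof -
    have "0 = (\<Sum>k<s * n. if k div s = b then \<Sum>j<s * n. ?P $$ (k, j) * vec_index v j else 0)"
      by (rule sum.neutral[symmetric]) (simp add: row)
    also have "\<dots> = (\<Sum>k<s * n. \<Sum>j<s * n. (if k div s = b then ?P $$ (k, j) else 0) * vec_index v j)"
      by (intro sum.cong refl) simp
    also have "\<dots> = (\<Sum>j<s * n. (\<Sum>k<s * n. if k div s = b then ?P $$ (k, j) else 0) * vec_index v j)"
      by (subst sum.swap) (simp add: sum_distrib_right)
    also have "\<dots> = (\<Sum>j<s * n. (if j = 0 \<or> j = b * s then s else 0) * vec_index v j)"
      using colsum that by (intro sum.cong refl) simp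
    finally show ?thesis by simp
  qed
  have v0: "vec_index v 0 = 0"
  proof -
    have "(\<Sum>j<s * n. if j = 0 then s * vec_index v j else 0)
        = (\<Sum>j<s * n. (if j = 0 \<or> j = 0 * s then s else 0) * vec_index v j)"
      by (intro sum.cong refl) simp
    also have "\<dots> = 0" using blk[of 0] assms by simp
    finally show ?thesis using pos assms by simp
  qed
  have vb: "vec_index v j = 0" if j: "j < s * n" "s dvd j" for j
  proof (cases "j = 0")
    case False
    have e: "j div s * s = j" using j by simp
    have "0 = (\<Sum>i<s * n. (if i = 0 \<or> i = j div s * s then s else 0) * vec_index v i)"
      using blk[OF div_less_blocks[OF j(1)]] by simp
    also have "\<dots> = (\<Sum>i<s * n. if i = j then s * vec_index v i else 0)"
      unfolding e using v0 by (intro sum.cong refl) auto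
    also have "\<dots> = s * vec_index v j" using j by simp
    finally show ?thesis using assms by simp
  qed (simp add: v0)
  have "vec_index v k = 0" if k: "k < s * n" for k
  proof (cases "s dvd k")
    case False
    have "0 = (\<Sum>j<s * n. ?P $$ (k, j) * vec_index v j)" using row[OF k] by simp
    also have "\<dots> = (\<Sum>j<s * n. if j = k then vec_index v j else 0)"
      using k False v0 vb by (intro sum.cong refl) (auto simp: eigbasis_def)
    finally show ?thesis using k by simp
  qed (simp add: vb k)
  then have "v = 0\<^sub>v (s * n)" using v(1) by (intro eq_vecI) auto
  then show False using v(2) by simp
qed

lemma proots_char_poly_bmat:
  assumes "s \<ge> 1" "n \<ge> 1"
  shows "proots (char_poly (bmat s n x y 0))
    = {#x#} + replicate_mset (n - 1) y + replicate_mset (s * n - n) 0"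
proof -
  let ?P = "eigbasis s n" and ?T = "eigtri s n x y" and ?M = "bmat s n x y 0"
  let ?A = "{j. j < s * n \<and> s dvd j} - {0}" and ?B = "{..<s * n} - {j. j < s * n \<and> s dvd j}"
  have c: "?P \<in> carrier_mat (s * n) (s * n)" "?T \<in> carrier_mat (s * n) (s * n)"
    by (auto simp: eigbasis_def eigtri_def)
  obtain Q where Q: "Q \<in> carrier_mat (s * n) (s * n)" "?P * Q = 1\<^sub>m (s * n)" "Q * ?P = 1\<^sub>m (s * n)"
    using det_non_zero_imp_unit[OF c(1) eigbasis_det[OF assms], of "()"]
    unfolding Units_def by (auto simp: ring_mat_def)
  have "?M = ?M * (?P * Q)" using Q right_mult_one_mat[OF bmat_carrier] by simp
  also have "\<dots> = ?M * ?P * Q" using c Q by (simp add: assoc_mult_mat[of _ "s * n" "s * n"])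
  also have "\<dots> = ?P * ?T * Q" using bmat_eigbasis[OF assms] by simp
  finally have "similar_mat ?M ?T"
    unfolding similar_mat_def similar_mat_wit_def
    by (intro exI[of _ ?P] exI[of _ Q]) (use c Q in \<open>auto simp: Let_def bmat_def\<close>)
  then have "char_poly ?M = char_poly ?T" by (rule char_poly_similar)
  also have "\<dots> = (\<Prod>a\<leftarrow>diag_mat ?T. [:- a, 1:])"
    using c by (intro char_poly_upper_triangular[of _ "s * n"]) (auto simp: eigtri_def)
  finally have "proots (char_poly ?M) = mset (diag_mat ?T)" by (simp add: proots_prod_list_linear)
  also have "\<dots> = image_mset (\<lambda>i. if i = 0 then x else if s dvd i then y else 0) (mset_set {..<s * n})"
    unfolding diag_mat_def mset_map
    by (auto simp: eigtri_def mset_upt lessThan_atLeast0 intro!: image_mset_cong)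
  also have "mset_set {..<s * n} = {#0#} + mset_set ?A + mset_set ?B"
  proof -
    have eq: "{..<s * n} = insert 0 (?A \<union> ?B)" using assms by auto
    have "mset_set (insert 0 (?A \<union> ?B)) = {#0#} + mset_set (?A \<union> ?B)"
      by (subst mset_set.insert) auto
    also have "mset_set (?A \<union> ?B) = mset_set ?A + mset_set ?B"
      by (rule mset_set_Union) auto
    finally show ?thesis unfolding eq[symmetric] by (simp only: add.assoc)
  qed
  also have "image_mset (\<lambda>i. if i = 0 then x else if s dvd i then y else 0) \<dots>
     = {#x#} + image_mset (\<lambda>_. y) (mset_set ?A) + image_mset (\<lambda>_. 0) (mset_set ?B)"
    by (auto intro!: image_mset_cong arg_cong2[of _ _ _ _ plus])
  also have "\<dots> = {#x#} + replicate_mset (n - 1) y + replicate_mset (s * n - n) 0"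
    using assms by (simp add: image_mset_const_eq card_multiples_below card_Diff_subset subset_eq)
  finally show ?thesis .
qed

text \<open>The matrix is symmetric, so its Gram matrix has the eigenvalues \<open>x^2\<close>,
  \<open>y^2\<close> and 0; the square roots return \<open>x\<close> and \<open>y\<close> because
  both are nonnegative, and \<open>x \<ge> y\<close> settles the order.\<close>

lemma sing_val_bmat:
  assumes "s \<ge> 1" "n \<ge> 1" "x \<ge> y" "y \<ge> 0"
  shows "sing_val (bmat s n x y 0) 1 = x"
    and "i \<in> {2..n} \<Longrightarrow> sing_val (bmat s n x y 0) i = y"
    and "j \<in> {n<..s * n} \<Longrightarrow> sing_val (bmat s n x y 0) j = 0"
proof -
  let ?l = "x # replicate (n - 1) y @ replicate (s * n - n) 0"
  have "image_mset sqrt (proots (char_poly (transpose_mat (bmat s n x y 0) * bmat s n x y 0))) = mset (rev ?l)"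
    using assms by (simp add: bmat_mult proots_char_poly_bmat del: replicate_mset_eq_empty_iff)
  then have "singular_values (bmat s n x y 0) = rev (sort (rev ?l))"
    by (simp only: singular_values_def sorted_list_of_multiset_mset)
  also have "sort (rev ?l) = rev ?l"
    using assms by (intro sorted_sort_id) (auto simp: sorted_append)
  finally have sv: "singular_values (bmat s n x y 0) = ?l" by simp
  show "sing_val (bmat s n x y 0) 1 = x" by (simp add: sing_val_def sv)
  show "i \<in> {2..n} \<Longrightarrow> sing_val (bmat s n x y 0) i = y"
    by (auto simp: sing_val_def sv nth_Cons' nth_append)
  show "j \<in> {n<..s * n} \<Longrightarrow> sing_val (bmat s n x y 0) j = 0"
    using assms(2) by (auto simp: sing_val_def sv nth_Cons' nth_append)
qed

section \<open>Scalar differential equations\<close>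

lemma at_within_Ici: "0 < t \<Longrightarrow> at t within {0..} = at (t::real)"
  by (rule at_within_interior) simp

text \<open>All comparison arguments go through this form. The derivative at time 0 is one-sided, so
  the sign of the derivative is used on the open interval and continuity at its end points.\<close>

lemma nonincreasing_on:
  fixes f :: "real \<Rightarrow> real"
  assumes "0 \<le> a" "a \<le> b"
    and der: "\<And>t. a \<le> t \<Longrightarrow> t \<le> b \<Longrightarrow> (f has_real_derivative f' t) (at t within {0..})"
    and nonpos: "\<And>t. a \<le> t \<Longrightarrow> t \<le> b \<Longrightarrow> f' t \<le> 0"
  shows "f b \<le> f a"
proof (rule DERIV_nonpos_imp_decreasing_open[OF \<open>a \<le> b\<close>])
  show "\<exists>y. DERIV f t :> y \<and> y \<le> 0" if "a < t" "t < b" for t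
    using der[of t] nonpos[of t] that assms(1) at_within_Ici[of t] by auto
  have "continuous_on {a..b} f"
    unfolding continuous_on_eq_continuous_within
  proof
    fix t assume t: "t \<in> {a..b}"
    then have "(f has_real_derivative f' t) (at t within {a..b})"
      using der[of t] assms(1) by (auto intro: has_field_derivative_subset)
    then show "continuous (at t within {a..b}) f" by (rule DERIV_continuous)
  qed
  then show "continuous_on {a..b} f" .
qed

text \<open>Integrating factor: \<open>c\<close> is the exponential of the integral of
  \<open>h\<close>. Only its positivity matters later, where it shows that \<open>x\<close>,
  \<open>y\<close>, \<open>z\<close> stay positive and that \<open>r\<close> keeps its sign.\<close>

lemma linear_ode_factor:
  fixes y h :: "real \<Rightarrow> real"
  assumes der: "\<And>t. 0 \<le> t \<Longrightarrow> (y has_real_derivative h t * y t) (at t within {0..})"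
    and cont: "continuous_on {0..} h" and T: "0 \<le> T"
  obtains c where "c > 0" "y T = y 0 * c"
proof (rule that)
  let ?H = "\<lambda>t. integral {0..t} h"
  have ct: "continuous_on {0..T} h" using cont by (rule continuous_on_subset) auto
  have "((\<lambda>t. y t * exp (- ?H t)) has_real_derivative 0) (at t within {0..T})" if t: "t \<in> {0..T}" for t
  proof -
    have "(y has_real_derivative h t * y t) (at t within {0..T})"
      using der[of t] t by (auto intro: has_field_derivative_subset)
    moreover have "(?H has_real_derivative h t) (at t within {0..T})"
      by (rule integral_has_real_derivative[OF ct t])
    ultimately show ?thesis
      by (auto intro!: derivative_eq_intros simp: algebra_simps)
  qed
  then have "\<exists>c. \<forall>t\<in>{0..T}. y t * exp (- ?H t) = c"
    by (intro has_field_derivative_zero_constant convex_real_interval)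
  then obtain c where c: "\<And>t. t \<in> {0..T} \<Longrightarrow> y t * exp (- ?H t) = c" by blast
  have "y T * exp (- ?H T) = y 0" using c[of T] c[of 0] T by simp
  then have "y T * exp (- ?H T) * exp (?H T) = y 0 * exp (?H T)" by simp
  then show "y T = y 0 * exp (?H T)" by (simp add: mult.assoc flip: exp_add)
qed simp

lemma antimono_limit:
  fixes f :: "real \<Rightarrow> real"
  assumes dec: "\<And>a b. 0 \<le> a \<Longrightarrow> a \<le> b \<Longrightarrow> f b \<le> f a" and bd: "\<And>t. 0 \<le> t \<Longrightarrow> B \<le> f t"
  obtains l where "(f \<longlongrightarrow> l) at_top" "B \<le> l" "\<And>t. 0 \<le> t \<Longrightarrow> l \<le> f t"
proof -
  define l where "l = Inf (f ` {0..})"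
  have bb: "bdd_below (f ` {0..})" using bd by (auto intro!: bdd_belowI[of _ B])
  have lf: "l \<le> f t" if "0 \<le> t" for t
    unfolding l_def using bb that by (auto intro: cInf_lower)
  have "B \<le> l" unfolding l_def using bd by (intro cInf_greatest) auto
  moreover have "(f \<longlongrightarrow> l) at_top"
  proof (rule order_tendstoI)
    fix a assume "a < l"
    then have "a < f t" if "0 \<le> t" for t using lf[OF that] by linarith
    then show "eventually (\<lambda>t. a < f t) at_top" by (rule eventually_at_top_linorderI)
  next
    fix a assume "l < a"
    then obtain t where "0 \<le> t" "f t < a"
      unfolding l_def using cInf_lessD[of "f ` {0..}" a] by auto
    then have "f u < a" if "t \<le> u" for u using dec[of t u] that by linarith
    then show "eventually (\<lambda>t. f t < a) at_top" by (rule eventually_at_top_linorderI)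
  qed
  ultimately show ?thesis using that lf by blast
qed

lemma has_real_derivative_imp_continuous_on:
  assumes "\<And>t. 0 \<le> t \<Longrightarrow> (f has_real_derivative f' t) (at t within {0..})"
  shows "continuous_on {0..} f"
  using assms unfolding continuous_on_eq_continuous_within
  by (auto intro: DERIV_continuous)

lemma power_flow_decay:
  fixes z :: "real \<Rightarrow> real"
  assumes der: "\<And>t. 0 \<le> t \<Longrightarrow> (z has_real_derivative - (z t ^ k)) (at t within {0..})"
    and "k \<ge> 1" and z0: "z 0 > 0"
  shows "(z \<longlongrightarrow> 0) at_top"
proof -
  have cz: "continuous_on {0..} z" by (rule has_real_derivative_imp_continuous_on[OF der])
  have dz: "(z has_real_derivative (- (z t ^ (k - 1))) * z t) (at t within {0..})" if "0 \<le> t" for t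
    using der[OF that] power_minus_mult[of k "z t"] \<open>k \<ge> 1\<close> by simp
  have cz': "continuous_on {0..} (\<lambda>t. - (z t ^ (k - 1)))" by (intro continuous_intros cz)
  have pos: "z t > 0" if t: "0 \<le> t" for t
  proof -
    obtain c where "c > 0" "z t = z 0 * c" using dz cz' t by (rule linear_ode_factor)
    then show ?thesis using z0 by simp
  qed
  have dec: "z b \<le> z a" if "0 \<le> a" "a \<le> b" for a b
  proof (rule nonincreasing_on[OF that])
    fix t assume "a \<le> t" "t \<le> b"
    then have t: "0 \<le> t" using that by simp
    show "(z has_real_derivative - (z t ^ k)) (at t within {0..})" by (rule der[OF t])
    show "- (z t ^ k) \<le> 0" using less_imp_le[OF pos[OF t]] by simp
  qed
  obtain l where l: "(z \<longlongrightarrow> l) at_top" "0 \<le> l" "\<And>t. 0 \<le> t \<Longrightarrow> l \<le> z t"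
    by (rule antimono_limit[of z 0]) (use dec less_imp_le[OF pos] in auto)
  have "l = 0"
  proof (rule ccontr)
    assume "l \<noteq> 0"
    then have lk: "l ^ k > 0" using l(2) by simp
    \<comment> \<open>If the limit were positive, \<open>z\<close> would decrease at least at rate
      \<open>l ^ k\<close>, and at this time it would have used up its initial value.\<close>
    define T where "T = z 0 / l ^ k"
    have T: "0 \<le> T" using lk z0 by (simp add: T_def)
    have "z T + l ^ k * T \<le> z 0 + l ^ k * 0"
    proof (rule nonincreasing_on[OF _ T])
      fix t :: real assume t: "0 \<le> t" "t \<le> T"
      show "((\<lambda>t. z t + l ^ k * t) has_real_derivative - (z t ^ k) + l ^ k * 1) (at t within {0..})"
        by (intro DERIV_add der[OF t(1)] DERIV_cmult DERIV_ident)
      show "- (z t ^ k) + l ^ k * 1 \<le> 0" using power_mono[OF l(3)[OF t(1)] l(2)] by simp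
    qed simp
    moreover have "l ^ k * T = z 0" using lk unfolding T_def by (metis less_irrefl nonzero_mult_div_cancel_left times_divide_eq_right)
    ultimately have "z T \<le> 0" by simp
    then show False using pos[OF T] by simp
  qed
  then show ?thesis using l(1) by simp
qed

section \<open>The coupled equations for x and y\<close>

locale reduced_flow =
  fixes x y :: "real \<Rightarrow> real" and n s L :: nat and w :: real and r :: "real \<Rightarrow> real"
  assumes n: "n \<ge> 2" and s: "s \<ge> 1" and L: "L \<ge> 2" and w: "w > 0"
    and init: "y 0 > 0" "y 0 \<le> x 0"
    and r_def: "\<And>t. r t = (x t ^ L - y t ^ L) / n + y t ^ L - s * w"
    and dx: "\<And>t. 0 \<le> t \<Longrightarrow> (x has_real_derivative - (r t * x t ^ (L - 1))) (at t within {0..})"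
    and dy: "\<And>t. 0 \<le> t \<Longrightarrow> (y has_real_derivative - (r t * y t ^ (L - 1))) (at t within {0..})"
begin

lemma cont: "continuous_on {0..} x" "continuous_on {0..} y" "continuous_on {0..} r"
proof -
  show cx: "continuous_on {0..} x" by (rule has_real_derivative_imp_continuous_on[OF dx])
  show cy: "continuous_on {0..} y" by (rule has_real_derivative_imp_continuous_on[OF dy])
  show "continuous_on {0..} r" unfolding r_def using n by (auto intro!: continuous_intros cx cy)
qed

lemma power_pred: "a ^ (L - 1) = a ^ (L - 2) * (a::real)"
  using L by (metis One_nat_def Suc_diff_Suc Suc_1 less_eq_Suc_le power_Suc2)

text \<open>Because \<open>L \<ge> 2\<close>, a factor \<open>x t\<close> splits off the right-hand
  side, and the equation becomes linear with the continuous coefficient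
  \<open>- r t * x t ^ (L - 2)\<close>.\<close>

lemma pos: assumes "0 \<le> t" shows "0 < x t" "0 < y t"
proof -
  have "(x has_real_derivative (- (r t * x t ^ (L - 2))) * x t) (at t within {0..})" if "0 \<le> t" for t
    using dx[OF that] unfolding power_pred by (simp add: mult.assoc)
  moreover have "continuous_on {0..} (\<lambda>t. - (r t * x t ^ (L - 2)))"
    by (intro continuous_intros cont)
  ultimately obtain c where "c > 0" "x t = x 0 * c" using assms by (rule linear_ode_factor)
  then show "0 < x t" using init by simp
  have "(y has_real_derivative (- (r t * y t ^ (L - 2))) * y t) (at t within {0..})" if "0 \<le> t" for t
    using dy[OF that] unfolding power_pred by (simp add: mult.assoc)
  moreover have "continuous_on {0..} (\<lambda>t. - (r t * y t ^ (L - 2)))"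
    by (intro continuous_intros cont)
  ultimately obtain c where "c > 0" "y t = y 0 * c" using assms by (rule linear_ode_factor)
  then show "0 < y t" using init by simp
qed

text \<open>For \<open>L = 2\<close> both logarithmic derivatives equal \<open>- r\<close>.\<close>

lemma ratio_conserved:
  assumes "L = 2" "0 \<le> t" shows "x t * y 0 = y t * x 0"
proof -
  have "((\<lambda>t. x t / y t) has_real_derivative 0) (at t within {0..})" if "0 \<le> t" for t
    using dx[OF that] dy[OF that] pos[OF that] assms
    by (auto intro!: derivative_eq_intros)
  then have "\<exists>c. \<forall>t\<in>{0..}. x t / y t = c"
    by (intro has_field_derivative_zero_constant convex_real_interval) auto
  then obtain c where "\<And>t. t \<in> {0..} \<Longrightarrow> x t / y t = c" by blast
  then have "x t / y t = x 0 / y 0" using assms(2) by simp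
  then show ?thesis using pos[OF assms(2)] pos[of 0] by (simp add: field_simps)
qed

text \<open>Along the flow \<open>x^(2-L)\<close> and \<open>y^(2-L)\<close> have the same
  derivative \<open>(L - 2) * r\<close>. For \<open>L = 2\<close> the equation reads
  \<open>0 = 0\<close>, which is why the ratio is treated separately. In the proof
  \<open>L - 2\<close> becomes \<open>Suc k\<close>, so that differentiating involves no truncated
  subtraction.\<close>

lemma power_conserved:
  assumes "0 \<le> t"
  shows "inverse (x t ^ (L - 2)) - inverse (y t ^ (L - 2)) = inverse (x 0 ^ (L - 2)) - inverse (y 0 ^ (L - 2))"
proof (cases "L = 2")
  case False
  define k where "k = L - 3"
  have k: "L = Suc (Suc (Suc k))" using False L by (simp add: k_def)
  have *: "((\<lambda>t. inverse (z t ^ (L - 2))) has_real_derivative (L - 2) * r t) (at t within {0..})"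
    if "0 \<le> t" "z t > 0" "(z has_real_derivative - (r t * z t ^ (L - 1))) (at t within {0..})" for z t
  proof -
    have "((\<lambda>t. z t ^ Suc k) has_real_derivative real (Suc k) * (- (r t * z t ^ (L - 1)) * z t ^ (Suc k - Suc 0)))
        (at t within {0..})" by (rule DERIV_power) (rule that(3))
    moreover have "z t ^ Suc k \<noteq> 0" using that(2) by simp
    ultimately have "((\<lambda>t. inverse (z t ^ Suc k)) has_real_derivative
        - (real (Suc k) * (- (r t * z t ^ (L - 1)) * z t ^ (Suc k - Suc 0)) *
           inverse ((z t ^ Suc k) ^ Suc (Suc 0)))) (at t within {0..})"
      by (rule DERIV_inverse_fun)
    also have "- (real (Suc k) * (- (r t * z t ^ (L - 1)) * z t ^ (Suc k - Suc 0)) *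
           inverse ((z t ^ Suc k) ^ Suc (Suc 0))) = (L - 2) * r t"
      using that(2) by (simp add: k field_simps)
    finally show ?thesis by (simp add: k)
  qed
  have "((\<lambda>t. inverse (x t ^ (L - 2)) - inverse (y t ^ (L - 2))) has_real_derivative 0) (at t within {0..})"
    if "0 \<le> t" for t
    using DERIV_diff[OF *[OF that pos(1)[OF that] dx[OF that]] *[OF that pos(2)[OF that] dy[OF that]]]
    by simp
  then have "\<exists>c. \<forall>t\<in>{0..}. inverse (x t ^ (L - 2)) - inverse (y t ^ (L - 2)) = c"
    by (intro has_field_derivative_zero_constant convex_real_interval) auto
  then obtain c where "\<And>t. t \<in> {0..} \<Longrightarrow> inverse (x t ^ (L - 2)) - inverse (y t ^ (L - 2)) = c" by blast
  then show ?thesis using assms by simp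
qed simp

text \<open>The conserved quantity keeps its initial sign, and that sign encodes the order of
  \<open>x\<close> and \<open>y\<close>.\<close>

lemma y_le_x: assumes "0 \<le> t" shows "y t \<le> x t"
proof (cases "L = 2")
  case True
  have "y t * y 0 \<le> y t * x 0" using init pos[OF assms] by (intro mult_left_mono) auto
  also have "\<dots> = x t * y 0" using ratio_conserved[OF True assms] by simp
  finally show ?thesis using init by simp
next
  case False
  have "inverse (x 0 ^ (L - 2)) \<le> inverse (y 0 ^ (L - 2))"
    using init by (intro le_imp_inverse_le power_mono) auto
  then have "inverse (x t ^ (L - 2)) \<le> inverse (y t ^ (L - 2))"
    using power_conserved[OF assms] by linarith
  then have "y t ^ (L - 2) \<le> x t ^ (L - 2)"
    using pos[OF assms] by (simp add: inverse_le_iff_le)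
  moreover have "0 < L - 2" using False L by simp
  ultimately show ?thesis using pos[OF assms] by (simp add: power_mono_iff)
qed

text \<open>The chain rule applied to \<open>(x^L + (n - 1) y^L) / n\<close> along the flow produces
  \<open>- q * r\<close>; as a sum of squares \<open>q\<close> is nonnegative.\<close>

definition q where "q t = L / n * ((x t ^ (L - 1))\<^sup>2 + (real n - 1) * (y t ^ (L - 1))\<^sup>2)"

lemma dr: assumes "0 \<le> t" shows "(r has_real_derivative - q t * r t) (at t within {0..})"
proof -
  define X Y where "X = x t ^ (L - 1)" and "Y = y t ^ (L - 1)"
  have dX: "((\<lambda>t. x t ^ L) has_real_derivative L * (- (r t * X) * X)) (at t within {0..})"
    using DERIV_power[OF dx[OF assms], of L] by (simp add: X_def)
  have dY: "((\<lambda>t. y t ^ L) has_real_derivative L * (- (r t * Y) * Y)) (at t within {0..})"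
    using DERIV_power[OF dy[OF assms], of L] by (simp add: Y_def)
  have r_eq: "r = (\<lambda>t. (x t ^ L - y t ^ L) / n + y t ^ L - s * w)" by (rule ext) (rule r_def)
  have "(r has_real_derivative
      (L * (- (r t * X) * X) - L * (- (r t * Y) * Y)) / n + L * (- (r t * Y) * Y) - 0) (at t within {0..})"
    by (subst r_eq) (intro DERIV_diff DERIV_add DERIV_cdivide DERIV_const dX dY)
  also have "(L * (- (r t * X) * X) - L * (- (r t * Y) * Y)) / n + L * (- (r t * Y) * Y) - 0 = - q t * r t"
    using n unfolding q_def X_def[symmetric] Y_def[symmetric]
    by (simp add: power2_eq_square divide_simps) (simp add: algebra_simps)
  finally show ?thesis .
qed

text \<open>As a solution of a linear homogeneous equation, \<open>r\<close> is a positive multiple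
  of its initial value: the flow never overshoots the target.\<close>

lemma r_sign:
  assumes "0 \<le> t"
  shows "r 0 \<ge> 0 \<Longrightarrow> r t \<ge> 0" and "r 0 \<le> 0 \<Longrightarrow> r t \<le> 0"
proof -
  have "continuous_on {0..} (\<lambda>t. - q t)"
    unfolding q_def using n by (intro continuous_intros cont) auto
  then obtain c where "c > 0" "r t = r 0 * c"
    using linear_ode_factor[OF dr _ assms] by blast
  then show "r 0 \<ge> 0 \<Longrightarrow> r t \<ge> 0" and "r 0 \<le> 0 \<Longrightarrow> r t \<le> 0"
    by (auto simp: mult_le_0_iff)
qed

lemma monotone_flow:
  assumes "0 \<le> a" "a \<le> b"
  shows "r 0 \<ge> 0 \<Longrightarrow> x b \<le> x a \<and> y b \<le> y a" and "r 0 \<le> 0 \<Longrightarrow> x a \<le> x b \<and> y a \<le> y b"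
proof -
  have P: "0 < x t ^ (L - 1)" "0 < y t ^ (L - 1)" if "a \<le> t" for t
    using pos[of t] that assms by simp_all
  have t0: "0 \<le> t" if "a \<le> t" for t using that assms by linarith
  show "x b \<le> x a \<and> y b \<le> y a" if "r 0 \<ge> 0"
  proof
    have R: "0 \<le> r t" if "a \<le> t" for t using r_sign(1)[OF t0[OF that]] \<open>r 0 \<ge> 0\<close> .
    show "x b \<le> x a"
    proof (rule nonincreasing_on[OF assms dx[OF t0]])
      show "- (r t * x t ^ (L - 1)) \<le> 0" if "a \<le> t" for t using R[OF that] P[OF that] by simp
    qed
    show "y b \<le> y a"
    proof (rule nonincreasing_on[OF assms dy[OF t0]])
      show "- (r t * y t ^ (L - 1)) \<le> 0" if "a \<le> t" for t using R[OF that] P[OF that] by simp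
    qed
  qed
  show "x a \<le> x b \<and> y a \<le> y b" if "r 0 \<le> 0"
  proof
    have R: "r t \<le> 0" if "a \<le> t" for t using r_sign(2)[OF t0[OF that]] \<open>r 0 \<le> 0\<close> .
    have "- x b \<le> - x a"
    proof (rule nonincreasing_on[OF assms DERIV_minus[OF dx[OF t0]]])
      show "- (- (r t * x t ^ (L - 1))) \<le> 0" if "a \<le> t" for t
        using mult_nonpos_nonneg[OF R[OF that] less_imp_le[OF P(1)[OF that]]] by simp
    qed
    then show "x a \<le> x b" by simp
    have "- y b \<le> - y a"
    proof (rule nonincreasing_on[OF assms DERIV_minus[OF dy[OF t0]]])
      show "- (- (r t * y t ^ (L - 1))) \<le> 0" if "a \<le> t" for t
        using mult_nonpos_nonneg[OF R[OF that] less_imp_le[OF P(2)[OF that]]] by simp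
    qed
    then show "y a \<le> y b" by simp
  qed
qed

text \<open>If \<open>r 0 \<ge> 0\<close>, then \<open>r t \<ge> 0\<close> together with \<open>y t \<le> x t\<close> forces \<open>x t ^ L \<ge> s * w\<close>; otherwise \<open>x\<close>
  is nondecreasing.\<close>

lemma x_lower: "\<exists>\<mu>>0. \<forall>t\<ge>0. \<mu> \<le> x t"
proof (cases "r 0 \<ge> 0")
  case True
  have sw: "0 < s * w" using s w by simp
  show ?thesis
  proof (intro exI[of _ "root L (s * w)"] conjI allI impI)
    show "root L (s * w) > 0" using sw L by simp
    fix t :: real assume t: "0 \<le> t"
    have "y t ^ L \<le> x t ^ L" using y_le_x[OF t] pos[OF t] by (intro power_mono) auto
    then have "(x t ^ L - y t ^ L) / n \<le> (x t ^ L - y t ^ L) / 1"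
      using n by (intro divide_left_mono) auto
    then have "r t \<le> x t ^ L - s * w" by (simp add: r_def)
    moreover have "0 \<le> r t" using True r_sign(1)[OF t] by simp
    ultimately have "s * w \<le> x t ^ L" by linarith
    then have "root L (s * w) \<le> root L (x t ^ L)" using L by simp
    then show "root L (s * w) \<le> x t" using L pos[OF t] by (simp add: real_root_power_cancel)
  qed
next
  case False
  then show ?thesis using pos[of 0] monotone_flow(2)[of 0] by (intro exI[of _ "x 0"]) auto
qed

lemma r_tendsto: "(r \<longlongrightarrow> 0) at_top"
proof -
  obtain \<mu> where mu: "\<mu> > 0" "\<And>t. 0 \<le> t \<Longrightarrow> \<mu> \<le> x t" using x_lower by blast
  \<comment> \<open>A lower bound for \<open>q\<close> from its \<open>x\<close>-term alone, since
    nothing bounds \<open>y\<close> from below yet.\<close>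
  define \<kappa> where "\<kappa> = L / n * (\<mu> ^ (L - 1))\<^sup>2"
  have kappa: "\<kappa> > 0" using mu L n by (simp add: \<kappa>_def)
  have qk: "\<kappa> \<le> q t" if t: "0 \<le> t" for t
  proof -
    have "(\<mu> ^ (L - 1))\<^sup>2 \<le> (x t ^ (L - 1))\<^sup>2" using mu t by (intro power_mono) auto
    moreover have "0 \<le> (real n - 1) * (y t ^ (L - 1))\<^sup>2" using n by simp
    ultimately show ?thesis unfolding \<kappa>_def q_def by (intro mult_left_mono) auto
  qed
  \<comment> \<open>Squaring makes the comparison independent of the sign of
    \<open>r\<close>.\<close>
  have bound: "(r t)\<^sup>2 \<le> (r 0)\<^sup>2 * exp (- (2 * \<kappa>) * t)" if t: "0 \<le> t" for t
  proof -
    have "(r t)\<^sup>2 * exp (2 * \<kappa> * t) \<le> (r 0)\<^sup>2 * exp (2 * \<kappa> * 0)"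
    proof (rule nonincreasing_on[OF _ t])
      fix u :: real assume u: "0 \<le> u" "u \<le> t"
      show "((\<lambda>t. (r t)\<^sup>2 * exp (2 * \<kappa> * t)) has_real_derivative
          2 * (\<kappa> - q u) * ((r u)\<^sup>2 * exp (2 * \<kappa> * u))) (at u within {0..})"
        by (auto intro!: derivative_eq_intros dr[OF u(1)] simp: power2_eq_square algebra_simps)
      show "2 * (\<kappa> - q u) * ((r u)\<^sup>2 * exp (2 * \<kappa> * u)) \<le> 0"
        by (rule mult_nonpos_nonneg) (use qk[OF u(1)] in auto)
    qed simp
    then have "(r t)\<^sup>2 * exp (2 * \<kappa> * t) * exp (- (2 * \<kappa>) * t) \<le> (r 0)\<^sup>2 * exp (- (2 * \<kappa>) * t)"
      by (intro mult_right_mono) auto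
    then show ?thesis by (simp add: mult.assoc flip: exp_add)
  qed
  have "((\<lambda>t. exp (- (2 * \<kappa>) * t)) \<longlongrightarrow> 0) at_top"
    using kappa by (intro filterlim_compose[OF exp_at_bot]
      filterlim_tendsto_neg_mult_at_bot[OF tendsto_const _ filterlim_ident]) auto
  then have "((\<lambda>t. (r 0)\<^sup>2 * exp (- (2 * \<kappa>) * t)) \<longlongrightarrow> (r 0)\<^sup>2 * 0) at_top"
    by (rule tendsto_mult_left)
  then have "((\<lambda>t. (r t)\<^sup>2) \<longlongrightarrow> 0) at_top"
    by (intro tendsto_sandwich[of "\<lambda>_. 0" "\<lambda>t. (r t)\<^sup>2" at_top "\<lambda>t. (r 0)\<^sup>2 * exp (- (2 * \<kappa>) * t)"])
      (use bound in \<open>auto intro!: eventually_at_top_linorderI[of 0]\<close>)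
  then have "((\<lambda>t. sqrt ((r t)\<^sup>2)) \<longlongrightarrow> sqrt 0) at_top" by (rule tendsto_real_sqrt)
  then show ?thesis by (simp add: tendsto_rabs_zero_iff)
qed

text \<open>A nonpositive \<open>r\<close> bounds \<open>x^L\<close> by \<open>n * s * w\<close>.
  The summand 1 covers the case \<open>x t \<le> 1\<close>, where \<open>x t\<close> need not be at
  most \<open>x t ^ L\<close>.\<close>

lemma bounded_above: assumes "r 0 \<le> 0" "0 \<le> t" shows "x t \<le> 1 + n * s * w" "y t \<le> 1 + n * s * w"
proof -
  have "r t \<le> 0" using r_sign(2)[OF assms(2)] assms(1) by simp
  then have "n * r t \<le> 0" by (simp add: mult_le_0_iff)
  moreover have "n * r t = x t ^ L + (real n - 1) * y t ^ L - n * s * w"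
    using n by (simp add: r_def field_simps)
  moreover have "0 \<le> (real n - 1) * y t ^ L" using n pos[OF assms(2)] by simp
  ultimately have b: "x t ^ L \<le> n * s * w" by linarith
  have nsw: "0 \<le> n * s * w" using w by simp
  show "x t \<le> 1 + n * s * w"
  proof (cases "x t \<le> 1")
    case False
    then have "x t ^ 1 \<le> x t ^ L" using L by (intro power_increasing) auto
    then show ?thesis using b by simp
  qed (use nsw in linarith)
  then show "y t \<le> 1 + n * s * w" using y_le_x[OF assms(2)] by linarith
qed

lemma converges: obtains a b where "(x \<longlongrightarrow> a) at_top" "(y \<longlongrightarrow> b) at_top"
proof (cases "r 0 \<ge> 0")
  case True
  obtain a where a: "(x \<longlongrightarrow> a) at_top"
    by (rule antimono_limit[of x 0]) (use monotone_flow(1)[OF _ _ True] less_imp_le[OF pos(1)] in auto)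
  obtain b where b: "(y \<longlongrightarrow> b) at_top"
    by (rule antimono_limit[of y 0]) (use monotone_flow(1)[OF _ _ True] less_imp_le[OF pos(2)] in auto)
  show ?thesis using that a b by blast
next
  case False
  then have r0: "r 0 \<le> 0" by simp
  obtain a where a: "((\<lambda>t. - x t) \<longlongrightarrow> a) at_top"
    by (rule antimono_limit[of "\<lambda>t. - x t" "- (1 + n * s * w)"])
      (use monotone_flow(2)[OF _ _ r0] bounded_above[OF r0] in \<open>auto simp del: minus_add_distrib\<close>)
  obtain b where b: "((\<lambda>t. - y t) \<longlongrightarrow> b) at_top"
    by (rule antimono_limit[of "\<lambda>t. - y t" "- (1 + n * s * w)"])
      (use monotone_flow(2)[OF _ _ r0] bounded_above[OF r0] in \<open>auto simp del: minus_add_distrib\<close>)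
  show ?thesis using that tendsto_minus[OF a] tendsto_minus[OF b] by simp
qed

lemma limits:
  "\<exists>a b. (x \<longlongrightarrow> a) at_top \<and> (y \<longlongrightarrow> b) at_top \<and> 0 < b \<and> b \<le> a \<and>
    a ^ L + (real n - 1) * b ^ L = n * s * w \<and>
    (L = 2 \<longrightarrow> a * y 0 = b * x 0) \<and>
    inverse (a ^ (L - 2)) - inverse (b ^ (L - 2)) = inverse (x 0 ^ (L - 2)) - inverse (y 0 ^ (L - 2))"
proof -
  obtain a b where ab: "(x \<longlongrightarrow> a) at_top" "(y \<longlongrightarrow> b) at_top" by (rule converges)
  obtain \<mu> where mu: "\<mu> > 0" "\<And>t. 0 \<le> t \<Longrightarrow> \<mu> \<le> x t" using x_lower by blast
  have "\<mu> \<le> a"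
    by (rule tendsto_lowerbound[OF ab(1)]) (auto intro!: eventually_at_top_linorderI[of 0] mu)
  then have a: "a > 0" using mu by linarith
  have ba: "b \<le> a"
    by (rule tendsto_le[OF _ ab]) (auto intro!: eventually_at_top_linorderI[of 0] y_le_x)
  have b0: "0 \<le> b"
    by (rule tendsto_lowerbound[OF ab(2)]) (auto intro!: eventually_at_top_linorderI[of 0] less_imp_le pos)
  have "((\<lambda>t. (x t ^ L - y t ^ L) / n + y t ^ L - s * w) \<longlongrightarrow> (a ^ L - b ^ L) / n + b ^ L - s * w) at_top"
    using n by (intro tendsto_intros ab) auto
  then have "(a ^ L - b ^ L) / n + b ^ L - s * w = 0"
    using r_tendsto unfolding r_def[abs_def] by (intro tendsto_unique[of at_top]) auto
  then have sum: "a ^ L + (real n - 1) * b ^ L = n * s * w"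
    using n by (simp add: field_simps)
  have ratio: "a * y 0 = b * x 0" if "L = 2"
  proof (rule tendsto_unique[of at_top])
    show "((\<lambda>t. x t * y 0) \<longlongrightarrow> a * y 0) at_top" by (intro tendsto_intros ab)
    have "((\<lambda>t. y t * x 0) \<longlongrightarrow> b * x 0) at_top" by (intro tendsto_intros ab)
    moreover have "\<forall>\<^sub>F t in at_top. y t * x 0 = x t * y 0"
      using ratio_conserved[OF that] by (auto intro!: eventually_at_top_linorderI[of 0])
    ultimately show "((\<lambda>t. x t * y 0) \<longlongrightarrow> b * x 0) at_top" by (rule Lim_transform_eventually)
  qed simp
  define C where "C = inverse (x 0 ^ (L - 2)) - inverse (y 0 ^ (L - 2))"
  \<comment> \<open>The limit \<open>b\<close> is not yet known to be positive, so inverses cannot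
    be passed to the limit. For \<open>L \<ge> 3\<close>, the value \<open>b = 0\<close> would turn
    this equation into \<open>a ^ (L - 2) = 0\<close>.\<close>
  have pw: "b ^ (L - 2) - a ^ (L - 2) = C * a ^ (L - 2) * b ^ (L - 2)"
  proof (rule tendsto_unique[of at_top])
    show "((\<lambda>t. y t ^ (L - 2) - x t ^ (L - 2)) \<longlongrightarrow> b ^ (L - 2) - a ^ (L - 2)) at_top"
      by (intro tendsto_intros ab)
    have "((\<lambda>t. C * x t ^ (L - 2) * y t ^ (L - 2)) \<longlongrightarrow> C * a ^ (L - 2) * b ^ (L - 2)) at_top"
      by (intro tendsto_intros ab)
    moreover have "C * x t ^ (L - 2) * y t ^ (L - 2) = y t ^ (L - 2) - x t ^ (L - 2)" if "0 \<le> t" for t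
    proof -
      have "C = inverse (x t ^ (L - 2)) - inverse (y t ^ (L - 2))"
        using power_conserved[OF that] by (simp add: C_def)
      then show ?thesis using pos[OF that] by (simp add: field_simps)
    qed
    then have "\<forall>\<^sub>F t in at_top. C * x t ^ (L - 2) * y t ^ (L - 2) = y t ^ (L - 2) - x t ^ (L - 2)"
      by (auto intro!: eventually_at_top_linorderI[of 0])
    ultimately show "((\<lambda>t. y t ^ (L - 2) - x t ^ (L - 2)) \<longlongrightarrow> C * a ^ (L - 2) * b ^ (L - 2)) at_top"
      by (rule Lim_transform_eventually)
  qed simp
  have "b \<noteq> 0"
  proof
    assume b: "b = 0"
    show False
    proof (cases "L = 2")
      case True
      then show False using ratio b a init by simp
    next
      case False
      then have "L - 2 > 0" using L by simp
      then show False using pw b a by (simp add: zero_power)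
    qed
  qed
  then have b: "0 < b" using b0 by simp
  have "inverse (a ^ (L - 2)) - inverse (b ^ (L - 2)) = C"
    using pw a b by (simp add: field_simps)
  then show ?thesis using ab b ba sum ratio unfolding C_def by blast
qed

end

section \<open>The gradient of the loss\<close>

lemma factor_prod_carrier:
  assumes "\<And>l. l \<in> {1..k} \<Longrightarrow> V l \<in> carrier_mat d d"
  shows "factor_prod d k V \<in> carrier_mat d d"
  using assms
proof (induction k)
  case (Suc k)
  then have "V (Suc k) \<in> carrier_mat d d" "factor_prod d k V \<in> carrier_mat d d" by auto
  then show ?case by simp
qed simp

lemma factor_prod_cong:
  assumes "\<And>l. l \<in> {1..k} \<Longrightarrow> V l = V' l"
  shows "factor_prod d k V = factor_prod d k V'"
  using assms by (induction k) auto

lemma factor_prod_add: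
  assumes "\<And>q. q \<in> {1..k + l} \<Longrightarrow> V q \<in> carrier_mat d d"
  shows "factor_prod d (k + l) V = factor_prod d k (\<lambda>q. V (q + l)) * factor_prod d l V"
  using assms
proof (induction k)
  case 0
  then have "factor_prod d l V \<in> carrier_mat d d" by (intro factor_prod_carrier) auto
  then show ?case by simp
next
  case (Suc k)
  have "V (Suc k + l) \<in> carrier_mat d d" "factor_prod d l V \<in> carrier_mat d d"
    "factor_prod d k (\<lambda>q. V (q + l)) \<in> carrier_mat d d"
    using Suc.prems by (auto intro!: factor_prod_carrier)
  then show ?case using Suc by (simp add: assoc_mult_mat[of _ d d _ d _ d])
qed

abbreviation upper_prod :: "nat \<Rightarrow> nat \<Rightarrow> nat \<Rightarrow> (nat \<Rightarrow> real mat) \<Rightarrow> real mat" where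
  "upper_prod d L l V \<equiv> factor_prod d (L - l) (\<lambda>q. V (q + l))"

lemma factor_prod_split:
  assumes "\<And>q. q \<in> {1..L} \<Longrightarrow> V q \<in> carrier_mat d d" and l: "l \<in> {1..L}"
  shows "factor_prod d L V = upper_prod d L l V * (V l * factor_prod d (l - 1) V)"
proof -
  have "factor_prod d (L - l + l) V = upper_prod d L l V * factor_prod d l V"
    using assms by (intro factor_prod_add) auto
  moreover have "factor_prod d l V = V l * factor_prod d (l - 1) V"
    using l by (cases l) auto
  ultimately show ?thesis using l by simp
qed

lemma factor_prod_const_bmat:
  assumes "s \<ge> 1" "n \<ge> 1"
  shows "factor_prod (s * n) k (\<lambda>_. bmat s n x y z) = bmat s n (x ^ k) (y ^ k) (z ^ k)"
  using assms by (induction k) (simp_all add: bmat_one bmat_mult)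

lemma Omega_block_eq:
  assumes "s \<ge> 1"
  shows "Omega_block s n = {(a, b). a < s * n \<and> b < s * n \<and> a div s = b div s}"
proof (intro Set.set_eqI iffI; clarify)
  fix a b assume "(a, b) \<in> Omega_block s n"
  then obtain c where c: "1 \<le> c" "c \<le> n" "(c - 1) * s \<le> a" "a < c * s" "(c - 1) * s \<le> b" "b < c * s"
    by (auto simp: Omega_block_def)
  have "c * s \<le> n * s" using c by (intro mult_right_mono) auto
  moreover have "a div s = c - 1" "b div s = c - 1"
    using c assms by (auto intro!: div_nat_eqI simp: mult.commute)
  moreover have "a < n * s" "b < n * s" using c \<open>c * s \<le> n * s\<close> by linarith+
  ultimately show "a < s * n \<and> b < s * n \<and> a div s = b div s" by (simp add: mult.commute)
next
  fix a b assume ab: "a < s * n" "b < s * n" "a div s = b div s"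
  have "a div s < n" using ab by (simp add: div_less_blocks)
  moreover have "a div s * s \<le> a" "a < s + a div s * s" "b div s * s \<le> b" "b < s + b div s * s"
    using assms dividend_less_div_times[of s a] dividend_less_div_times[of s b] by auto
  \<comment> \<open>Blocks are numbered from 1 in \<open>Omega_block\<close>, quotients by
    \<open>s\<close> from 0.\<close>
  ultimately show "(a, b) \<in> Omega_block s n"
    unfolding Omega_block_def using ab(3) by (intro UN_I[of "Suc (a div s)"]) auto
qed

text \<open>The entry at \<open>(i, j)\<close> of \<open>U^T R P^T\<close>, where \<open>R\<close>
  is the residual restricted to the blocks, \<open>U\<close> the product of the factors after the
  one with index \<open>l\<close>, and \<open>P\<close> the product of those before it.\<close>

definition grad_entry ::
    "real \<Rightarrow> nat \<Rightarrow> nat \<Rightarrow> nat \<Rightarrow> (nat \<Rightarrow> real mat) \<Rightarrow> nat \<Rightarrow> nat \<Rightarrow> nat \<Rightarrow> real" where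
  "grad_entry w s n L V l i j = (\<Sum>a<s * n. \<Sum>b<s * n. upper_prod (s * n) L l V $$ (a, i)
     * (if a div s = b div s then factor_prod (s * n) L V $$ (a, b) - w else 0)
     * factor_prod (s * n) (l - 1) V $$ (j, b))"

text \<open>Changing one entry adds a multiple of a matrix unit to the factor, hence a rank-one
  matrix to the product. The product is affine in the entry and the loss quadratic, so its
  derivative can be read off.\<close>

lemma factor_prod_update:
  assumes V: "\<And>q. q \<in> {1..L} \<Longrightarrow> V q \<in> carrier_mat d d" and l: "l \<in> {1..L}"
    and ij: "i < d" "j < d" and ab: "a < d" "b < d"
  shows "factor_prod d L (V(l := update_mat (V l) (i, j) x)) $$ (a, b)
    = factor_prod d L V $$ (a, b)
      + (x - V l $$ (i, j)) * (upper_prod d L l V $$ (a, i) * factor_prod d (l - 1) V $$ (j, b))"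
proof -
  let ?X = "update_mat (V l) (i, j) x"
  let ?U = "upper_prod d L l V" and ?P = "factor_prod d (l - 1) V"
  have X: "?X \<in> carrier_mat d d" using V[OF l] by (auto simp: update_mat_def)
  have Xe: "?X $$ (k, m) = V l $$ (k, m) + (if k = i then if m = j then x - V l $$ (i, j) else 0 else 0)"
    if "k < d" "m < d" for k m
    using V[OF l] that by (auto simp: update_mat_def)
  have U: "?U \<in> carrier_mat d d" and P: "?P \<in> carrier_mat d d"
    using V l by (auto intro!: factor_prod_carrier)
  have Y: "(Y * ?P) \<in> carrier_mat d d" if "Y \<in> carrier_mat d d" for Y using that P by simp
  have entry: "(?U * (Y * ?P)) $$ (a, b) = (\<Sum>k<d. ?U $$ (a, k) * (\<Sum>m<d. Y $$ (k, m) * ?P $$ (m, b)))"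
    if Y': "Y \<in> carrier_mat d d" for Y
    by (simp only: mat_mult_entry[OF U Y[OF Y'] ab], intro sum.cong refl)
      (simp only: lessThan_iff mat_mult_entry[OF Y' P _ ab(2)])
  have "factor_prod d L (V(l := ?X)) = ?U * (?X * ?P)"
  proof -
    have "upper_prod d L l (V(l := ?X)) = ?U" "factor_prod d (l - 1) (V(l := ?X)) = ?P"
      using l by (auto intro!: factor_prod_cong)
    then show ?thesis using factor_prod_split[of L "V(l := ?X)" d l] V X l by simp
  qed
  then have "factor_prod d L (V(l := ?X)) $$ (a, b)
      = (\<Sum>k<d. ?U $$ (a, k) * (\<Sum>m<d. ?X $$ (k, m) * ?P $$ (m, b)))"
    using entry[OF X] by simp
  also have "\<dots> = (\<Sum>k<d. ?U $$ (a, k) * (\<Sum>m<d. V l $$ (k, m) * ?P $$ (m, b))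
      + (if k = i then ?U $$ (a, i) * ((x - V l $$ (i, j)) * ?P $$ (j, b)) else 0))"
  proof (intro sum.cong refl)
    fix k assume "k \<in> {..<d}"
    then have "(\<Sum>m<d. ?X $$ (k, m) * ?P $$ (m, b)) = (\<Sum>m<d. V l $$ (k, m) * ?P $$ (m, b)
        + (if m = j then (if k = i then (x - V l $$ (i, j)) * ?P $$ (j, b) else 0) else 0))"
      by (intro sum.cong refl) (auto simp: Xe algebra_simps)
    also have "\<dots> = (\<Sum>m<d. V l $$ (k, m) * ?P $$ (m, b))
        + (if k = i then (x - V l $$ (i, j)) * ?P $$ (j, b) else 0)"
      using ij by (simp add: sum.distrib)
    finally show "?U $$ (a, k) * (\<Sum>m<d. ?X $$ (k, m) * ?P $$ (m, b))
      = ?U $$ (a, k) * (\<Sum>m<d. V l $$ (k, m) * ?P $$ (m, b))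
        + (if k = i then ?U $$ (a, i) * ((x - V l $$ (i, j)) * ?P $$ (j, b)) else 0)"
      by (auto simp: algebra_simps)
  qed
  also have "\<dots> = (?U * (V l * ?P)) $$ (a, b) + ?U $$ (a, i) * ((x - V l $$ (i, j)) * ?P $$ (j, b))"
    using ij entry[OF V[OF l]] by (simp add: sum.distrib)
  finally show ?thesis using factor_prod_split[OF V l] by simp
qed

lemma partial_entry_phi:
  assumes V: "\<And>q. q \<in> {1..L} \<Longrightarrow> V q \<in> carrier_mat (s * n) (s * n)" and l: "l \<in> {1..L}"
    and ij: "i < s * n" "j < s * n" and s: "s \<ge> 1"
  shows "partial_entry (phi w s n L) V l (i, j) = grad_entry w s n L V l i j"
proof -
  let ?U = "upper_prod (s * n) L l V" and ?P = "factor_prod (s * n) (l - 1) V"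
  let ?F = "factor_prod (s * n) L V" and ?v = "V l $$ (i, j)"
  let ?c = "\<lambda>ab. ?U $$ (fst ab, i) * ?P $$ (j, snd ab)"
  have upd: "factor_prod (s * n) L (V(l := update_mat (V l) (i, j) x)) $$ ab = ?F $$ ab + (x - ?v) * ?c ab"
    if "ab \<in> Omega_block s n" for ab x
    using that factor_prod_update[OF V l ij, where a = "fst ab" and b = "snd ab" and x = x]
    by (auto simp: Omega_block_eq[OF s])
  have phi_eq: "phi w s n L (V(l := update_mat (V l) (i, j) x))
      = 1 / 2 * (\<Sum>ab\<in>Omega_block s n. (?F $$ ab + (x - ?v) * ?c ab - w)\<^sup>2)" for x
    unfolding phi_def loss_def
    by (intro arg_cong2[of _ _ _ _ "(*)"] refl sum.cong) (simp only: upd)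
  have "((\<lambda>x. 1 / 2 * (\<Sum>ab\<in>Omega_block s n. (?F $$ ab + (x - ?v) * ?c ab - w)\<^sup>2))
      has_real_derivative (\<Sum>ab\<in>Omega_block s n. ?U $$ (fst ab, i) * (?F $$ ab - w) * ?P $$ (j, snd ab))) (at ?v)"
    by (auto intro!: derivative_eq_intros simp: sum_distrib_left)
      (auto intro!: sum.cong simp: algebra_simps)
  then have "partial_entry (phi w s n L) V l (i, j)
      = (\<Sum>ab\<in>Omega_block s n. ?U $$ (fst ab, i) * (?F $$ ab - w) * ?P $$ (j, snd ab))"
    unfolding partial_entry_def phi_eq by (rule DERIV_imp_deriv)
  also have "\<dots> = (\<Sum>ab\<in>{..<s * n} \<times> {..<s * n}. ?U $$ (fst ab, i)
     * (if fst ab div s = snd ab div s then ?F $$ ab - w else 0) * ?P $$ (j, snd ab))"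
    by (rule sum.mono_neutral_cong_left) (auto simp: Omega_block_eq[OF s])
  also have "\<dots> = grad_entry w s n L V l i j"
    unfolding grad_entry_def by (subst sum.cartesian_product) (auto intro!: sum.cong)
  finally show ?thesis .
qed

lemma grad_entry_cong:
  assumes "\<And>q. q \<in> {1..L} \<Longrightarrow> V q = V' q" "l \<in> {1..L}"
  shows "grad_entry w s n L V l i j = grad_entry w s n L V' l i j"
proof -
  have eq: "upper_prod (s * n) L l V = upper_prod (s * n) L l V'"
    "factor_prod (s * n) (l - 1) V = factor_prod (s * n) (l - 1) V'"
    "factor_prod (s * n) L V = factor_prod (s * n) L V'"
    using assms by (auto intro!: factor_prod_cong)
  show ?thesis unfolding grad_entry_def by (simp only: eq)
qed

text \<open>All three matrices in \<open>U^T R P^T\<close> belong to the commutative algebra spanned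
  by the projections. The exponents \<open>L - l\<close> and \<open>l - 1\<close> add up to
  \<open>L - 1\<close>, so the gradient is the same for every \<open>l\<close>; this keeps equal
  factors equal.\<close>

lemma grad_entry_bmat:
  fixes x y z w :: real
  assumes sn: "s \<ge> 1" "n \<ge> 1" and l: "l \<in> {1..L}" and ij: "i < s * n" "j < s * n"
    and r: "r = (x ^ L - y ^ L) / n + y ^ L - s * w"
  shows "grad_entry w s n L (\<lambda>_. bmat s n x y z) l i j
    = bmat s n (r * x ^ (L - 1)) (r * y ^ (L - 1)) (z ^ L * z ^ (L - 1)) $$ (i, j)"
proof -
  let ?U = "bmat s n (x ^ (L - l)) (y ^ (L - l)) (z ^ (L - l))"
  let ?P = "bmat s n (x ^ (l - 1)) (y ^ (l - 1)) (z ^ (l - 1))"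
  let ?R = "bmat s n r r (z ^ L)"
  have sym: "bmat s n x y z $$ (a, b) = bmat s n x y z $$ (b, a)" if "a < s * n" "b < s * n" for a b x y z
    using that by (simp add: bmat_index eq_commute)
  have R: "(if a div s = b div s then bmat s n (x ^ L) (y ^ L) (z ^ L) $$ (a, b) - w else 0) = ?R $$ (a, b)"
    if "a < s * n" "b < s * n" for a b
    using that sn by (auto simp: bmat_index r divide_simps) (auto simp: algebra_simps)
  have "grad_entry w s n L (\<lambda>_. bmat s n x y z) l i j
      = (\<Sum>a<s * n. \<Sum>b<s * n. ?U $$ (i, a) * ?R $$ (a, b) * ?P $$ (b, j))"
    unfolding grad_entry_def factor_prod_const_bmat[OF sn]
    by (intro sum.cong refl) (simp only: lessThan_iff R sym[OF _ ij(1)] sym[OF ij(2)])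
  also have "\<dots> = (\<Sum>a<s * n. ?U $$ (i, a) * (?R * ?P) $$ (a, j))"
    using ij by (intro sum.cong refl)
      (simp add: mat_mult_entry[OF bmat_carrier bmat_carrier] sum_distrib_left mult.assoc del: index_mult_mat)
  also have "\<dots> = (?U * (?R * ?P)) $$ (i, j)"
    by (intro mat_mult_entry[symmetric] mult_carrier_mat[OF bmat_carrier bmat_carrier] bmat_carrier ij)
  also have "?U * (?R * ?P) = bmat s n (x ^ (L - l) * (r * x ^ (l - 1)))
      (y ^ (L - l) * (r * y ^ (l - 1))) (z ^ (L - l) * (z ^ L * z ^ (l - 1)))"
    using sn by (simp add: bmat_mult)
  also have "\<dots> = bmat s n (r * x ^ (L - 1)) (r * y ^ (L - 1)) (z ^ L * z ^ (L - 1))"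
  proof -
    have "u ^ (L - l) * (v * u ^ (l - 1)) = v * u ^ (L - 1)" for u v :: real
      using l by (simp add: mult.left_commute[of _ v] flip: power_add)
    then show ?thesis by (simp only:)
  qed
  finally show ?thesis .
qed

section \<open>Local Lipschitz bounds for products and gradient\<close>

lemma abs_sum_lessThan_le:
  fixes f :: "nat \<Rightarrow> real"
  assumes "\<And>q. q < d \<Longrightarrow> \<bar>f q\<bar> \<le> B"
  shows "\<bar>\<Sum>q<d. f q\<bar> \<le> d * B"
proof -
  have "\<bar>\<Sum>q<d. f q\<bar> \<le> (\<Sum>q<d. \<bar>f q\<bar>)" by (rule sum_abs)
  also have "\<dots> \<le> (\<Sum>q<d. B)" using assms by (intro sum_mono) auto
  finally show ?thesis by simp
qed

text \<open>The difference estimate needs the size estimates, so all three are proved in one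
  induction. With \<open>1 + M\<close> in place of \<open>M\<close>, one constant serves both: the
  product rule gives \<open>\<delta> * c + M * (c * \<delta>)\<close>, and each matrix product
  contributes another factor \<open>d\<close>.\<close>

lemma factor_prod_lipschitz:
  fixes M \<delta> :: real
  assumes V: "\<And>q. q \<in> {1..k} \<Longrightarrow> V q \<in> carrier_mat d d" "\<And>q. q \<in> {1..k} \<Longrightarrow> V' q \<in> carrier_mat d d"
    and M: "\<And>q i j. q \<in> {1..k} \<Longrightarrow> i < d \<Longrightarrow> j < d \<Longrightarrow> \<bar>V q $$ (i, j)\<bar> \<le> M"
      "\<And>q i j. q \<in> {1..k} \<Longrightarrow> i < d \<Longrightarrow> j < d \<Longrightarrow> \<bar>V' q $$ (i, j)\<bar> \<le> M"
    and \<delta>: "\<And>q i j. q \<in> {1..k} \<Longrightarrow> i < d \<Longrightarrow> j < d \<Longrightarrow> \<bar>V q $$ (i, j) - V' q $$ (i, j)\<bar> \<le> \<delta>"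
    and nonneg: "0 \<le> M" "0 \<le> \<delta>" and ij: "i < d" "j < d"
  shows "\<bar>factor_prod d k V $$ (i, j)\<bar> \<le> (d * (1 + M)) ^ k"
    and "\<bar>factor_prod d k V' $$ (i, j)\<bar> \<le> (d * (1 + M)) ^ k"
    and "\<bar>factor_prod d k V $$ (i, j) - factor_prod d k V' $$ (i, j)\<bar> \<le> (d * (1 + M)) ^ k * \<delta>"
proof -
  have "\<bar>factor_prod d k V $$ (i, j)\<bar> \<le> (d * (1 + M)) ^ k \<and>
    \<bar>factor_prod d k V' $$ (i, j)\<bar> \<le> (d * (1 + M)) ^ k \<and>
    \<bar>factor_prod d k V $$ (i, j) - factor_prod d k V' $$ (i, j)\<bar> \<le> (d * (1 + M)) ^ k * \<delta>"
    using V M \<delta> ij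
  proof (induction k arbitrary: i j)
    case 0
    then show ?case using nonneg by simp
  next
    case (Suc k)
    let ?c = "(d * (1 + M)) ^ k" and ?F = "factor_prod d k V" and ?F' = "factor_prod d k V'"
    have IH: "\<bar>?F $$ (i, j)\<bar> \<le> ?c" "\<bar>?F' $$ (i, j)\<bar> \<le> ?c" "\<bar>?F $$ (i, j) - ?F' $$ (i, j)\<bar> \<le> ?c * \<delta>"
      if "i < d" "j < d" for i j
      using Suc.IH[of i j] Suc.prems(1-5) that by auto
    have c0: "0 \<le> ?c" using nonneg by simp
    have cM: "M * ?c \<le> (1 + M) * ?c" using c0 by (simp add: algebra_simps)
    have carr: "V (Suc k) \<in> carrier_mat d d" "V' (Suc k) \<in> carrier_mat d d"
      "?F \<in> carrier_mat d d" "?F' \<in> carrier_mat d d"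
      using Suc.prems(1,2) by (auto intro!: factor_prod_carrier)
    have e: "factor_prod d (Suc k) V $$ (i, j) = (\<Sum>q<d. V (Suc k) $$ (i, q) * ?F $$ (q, j))"
      "factor_prod d (Suc k) V' $$ (i, j) = (\<Sum>q<d. V' (Suc k) $$ (i, q) * ?F' $$ (q, j))"
      unfolding factor_prod.simps
      using Suc.prems(6,7) by (intro mat_mult_entry carr; simp)+
    have 1: "\<bar>V (Suc k) $$ (i, q) * ?F $$ (q, j)\<bar> \<le> (1 + M) * ?c" if "q < d" for q
      unfolding abs_mult using IH[OF that Suc.prems(7)] Suc.prems(3)[of "Suc k" i q] Suc.prems(6) that nonneg cM
      by (intro order.trans[OF mult_mono cM]) auto
    have 2: "\<bar>V' (Suc k) $$ (i, q) * ?F' $$ (q, j)\<bar> \<le> (1 + M) * ?c" if "q < d" for q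
      unfolding abs_mult using IH[OF that Suc.prems(7)] Suc.prems(4)[of "Suc k" i q] Suc.prems(6) that nonneg cM
      by (intro order.trans[OF mult_mono cM]) auto
    have 3: "\<bar>V (Suc k) $$ (i, q) * ?F $$ (q, j) - V' (Suc k) $$ (i, q) * ?F' $$ (q, j)\<bar> \<le> (1 + M) * ?c * \<delta>"
      if "q < d" for q
    proof -
      have "V (Suc k) $$ (i, q) * ?F $$ (q, j) - V' (Suc k) $$ (i, q) * ?F' $$ (q, j)
        = (V (Suc k) $$ (i, q) - V' (Suc k) $$ (i, q)) * ?F $$ (q, j)
          + V' (Suc k) $$ (i, q) * (?F $$ (q, j) - ?F' $$ (q, j))" by (simp add: algebra_simps)
      also have "\<bar>\<dots>\<bar> \<le> \<bar>V (Suc k) $$ (i, q) - V' (Suc k) $$ (i, q)\<bar> * \<bar>?F $$ (q, j)\<bar>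
          + \<bar>V' (Suc k) $$ (i, q)\<bar> * \<bar>?F $$ (q, j) - ?F' $$ (q, j)\<bar>"
        unfolding abs_mult[symmetric] by (rule abs_triangle_ineq)
      also have "\<dots> \<le> \<delta> * ?c + M * (?c * \<delta>)"
        using IH[OF that Suc.prems(7)] Suc.prems(4)[of "Suc k" i q] Suc.prems(5)[of "Suc k" i q]
          Suc.prems(6) that nonneg
        by (intro add_mono mult_mono) auto
      finally show ?thesis by (simp add: algebra_simps)
    qed
    have "\<bar>\<Sum>q<d. V (Suc k) $$ (i, q) * ?F $$ (q, j)\<bar> \<le> d * ((1 + M) * ?c)" by (rule abs_sum_lessThan_le[OF 1])
    moreover have "\<bar>\<Sum>q<d. V' (Suc k) $$ (i, q) * ?F' $$ (q, j)\<bar> \<le> d * ((1 + M) * ?c)" by (rule abs_sum_lessThan_le[OF 2])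
    moreover have "\<bar>\<Sum>q<d. V (Suc k) $$ (i, q) * ?F $$ (q, j) - V' (Suc k) $$ (i, q) * ?F' $$ (q, j)\<bar>
      \<le> d * ((1 + M) * ?c * \<delta>)" by (rule abs_sum_lessThan_le[OF 3])
    ultimately show ?case unfolding e by (simp add: sum_subtractf mult_ac)
  qed
  then show "\<bar>factor_prod d k V $$ (i, j)\<bar> \<le> (d * (1 + M)) ^ k"
    and "\<bar>factor_prod d k V' $$ (i, j)\<bar> \<le> (d * (1 + M)) ^ k"
    and "\<bar>factor_prod d k V $$ (i, j) - factor_prod d k V' $$ (i, j)\<bar> \<le> (d * (1 + M)) ^ k * \<delta>" by auto
qed

lemma triple_product_diff:
  fixes u u' v v' p p' R \<delta> :: real
  assumes "\<bar>u\<bar> \<le> R" "\<bar>u'\<bar> \<le> R" "\<bar>v\<bar> \<le> R" "\<bar>v'\<bar> \<le> R" "\<bar>p\<bar> \<le> R" "\<bar>p'\<bar> \<le> R"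
    "\<bar>u - u'\<bar> \<le> \<delta>" "\<bar>v - v'\<bar> \<le> \<delta>" "\<bar>p - p'\<bar> \<le> \<delta>"
  shows "\<bar>u * v * p - u' * v' * p'\<bar> \<le> 3 * R\<^sup>2 * \<delta>"
proof -
  have R: "0 \<le> R" "0 \<le> \<delta>" using assms(1,7) by linarith+
  have m: "\<bar>a * b * c\<bar> \<le> R\<^sup>2 * \<delta>" if "\<bar>a\<bar> \<le> R" "\<bar>b\<bar> \<le> R" "\<bar>c\<bar> \<le> \<delta>" for a b c
    unfolding abs_mult power2_eq_square using that R by (intro mult_mono) auto
  have "u * v * p - u' * v' * p' = v * p * (u - u') + u' * p * (v - v') + u' * v' * (p - p')"
    by (simp add: algebra_simps)
  moreover have "\<bar>v * p * (u - u')\<bar> \<le> R\<^sup>2 * \<delta>" "\<bar>u' * p * (v - v')\<bar> \<le> R\<^sup>2 * \<delta>"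
    "\<bar>u' * v' * (p - p')\<bar> \<le> R\<^sup>2 * \<delta>"
    by (intro m assms)+
  ultimately show ?thesis by linarith
qed

text \<open>This feeds the Gronwall estimate for the distance to the block-symmetric families. The
  constant is uniform in the two families, and \<open>\<delta>\<close> may be any bound on their
  entrywise difference, so it can later be a Euclidean distance.\<close>

lemma grad_entry_lipschitz:
  fixes M w :: real
  assumes "0 \<le> M" "s * n \<ge> 1"
  obtains K where "0 \<le> K" "\<And>V V' \<delta> l i j.
    (\<And>q. q \<in> {1..L} \<Longrightarrow> V q \<in> carrier_mat (s * n) (s * n)) \<Longrightarrow>
    (\<And>q. q \<in> {1..L} \<Longrightarrow> V' q \<in> carrier_mat (s * n) (s * n)) \<Longrightarrow>
    (\<And>q i j. q \<in> {1..L} \<Longrightarrow> i < s * n \<Longrightarrow> j < s * n \<Longrightarrow> \<bar>V q $$ (i, j)\<bar> \<le> M) \<Longrightarrow>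
    (\<And>q i j. q \<in> {1..L} \<Longrightarrow> i < s * n \<Longrightarrow> j < s * n \<Longrightarrow> \<bar>V' q $$ (i, j)\<bar> \<le> M) \<Longrightarrow>
    (\<And>q i j. q \<in> {1..L} \<Longrightarrow> i < s * n \<Longrightarrow> j < s * n \<Longrightarrow> \<bar>V q $$ (i, j) - V' q $$ (i, j)\<bar> \<le> \<delta>) \<Longrightarrow>
    0 \<le> \<delta> \<Longrightarrow> l \<in> {1..L} \<Longrightarrow> i < s * n \<Longrightarrow> j < s * n \<Longrightarrow>
    \<bar>grad_entry w s n L V l i j - grad_entry w s n L V' l i j\<bar> \<le> K * \<delta>"
proof -
  define d where "d = s * n"
  define C where "C = (d * (1 + M)) ^ L"
  \<comment> \<open>The summand \<open>\<bar>w\<bar>\<close> lets the same bound cover the residual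
    entries.\<close>
  define R where "R = C + \<bar>w\<bar>"
  have "1 * 1 \<le> d * (1 + M)" using assms by (intro mult_mono) (auto simp: d_def simp flip: of_nat_mult)
  then have base: "1 \<le> d * (1 + M)" by simp
  then have C: "(d * (1 + M)) ^ k \<le> C" if "k \<le> L" for k
    unfolding C_def using that by (intro power_increasing) auto
  have C0: "0 \<le> C" using C[of 0] by simp
  have CR: "C \<le> R" by (simp add: R_def)
  show ?thesis
  proof (rule that[of "real d * (real d * (3 * R\<^sup>2 * C))"])
    show "0 \<le> real d * (real d * (3 * R\<^sup>2 * C))" using C0 by simp
    fix V V' :: "nat \<Rightarrow> real mat" and \<delta> :: real and l i j
    assume V: "\<And>q. q \<in> {1..L} \<Longrightarrow> V q \<in> carrier_mat (s * n) (s * n)"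
      "\<And>q. q \<in> {1..L} \<Longrightarrow> V' q \<in> carrier_mat (s * n) (s * n)"
      "\<And>q i j. q \<in> {1..L} \<Longrightarrow> i < s * n \<Longrightarrow> j < s * n \<Longrightarrow> \<bar>V q $$ (i, j)\<bar> \<le> M"
      "\<And>q i j. q \<in> {1..L} \<Longrightarrow> i < s * n \<Longrightarrow> j < s * n \<Longrightarrow> \<bar>V' q $$ (i, j)\<bar> \<le> M"
      "\<And>q i j. q \<in> {1..L} \<Longrightarrow> i < s * n \<Longrightarrow> j < s * n \<Longrightarrow> \<bar>V q $$ (i, j) - V' q $$ (i, j)\<bar> \<le> \<delta>"
      and \<delta>: "0 \<le> \<delta>" and l: "l \<in> {1..L}" and ij: "i < s * n" "j < s * n"
    \<comment> \<open>The shift \<open>h\<close> treats all partial products at once: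
      \<open>h = l\<close> is the product after the factor \<open>l\<close>, while
      \<open>h = 0\<close> gives the product before it and the full product.\<close>
    have lip: "\<bar>factor_prod d k (\<lambda>q. V (q + h)) $$ (a, b)\<bar> \<le> C \<and>
        \<bar>factor_prod d k (\<lambda>q. V' (q + h)) $$ (a, b)\<bar> \<le> C \<and>
        \<bar>factor_prod d k (\<lambda>q. V (q + h)) $$ (a, b) - factor_prod d k (\<lambda>q. V' (q + h)) $$ (a, b)\<bar> \<le> C * \<delta>"
      if k: "k + h \<le> L" and ab: "a < s * n" "b < s * n" for k h a b
    proof -
      have s: "q + h \<in> {1..L}" if "q \<in> {1..k}" for q using that k by auto
      have "\<bar>factor_prod d k (\<lambda>q. V (q + h)) $$ (a, b)\<bar> \<le> (d * (1 + M)) ^ k"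
        "\<bar>factor_prod d k (\<lambda>q. V' (q + h)) $$ (a, b)\<bar> \<le> (d * (1 + M)) ^ k"
        "\<bar>factor_prod d k (\<lambda>q. V (q + h)) $$ (a, b) - factor_prod d k (\<lambda>q. V' (q + h)) $$ (a, b)\<bar>
          \<le> (d * (1 + M)) ^ k * \<delta>"
        unfolding d_def
        by (rule factor_prod_lipschitz[of k "\<lambda>q. V (q + h)" "s * n" "\<lambda>q. V' (q + h)" M \<delta> a b];
          use V s \<delta> ab assms(1) in \<open>simp del: atLeastAtMost_iff\<close>)+
      moreover have "(d * (1 + M)) ^ k * \<delta> \<le> C * \<delta>" using C[of k] k \<delta> by (intro mult_right_mono) auto
      ultimately show ?thesis using C[of k] k by linarith
    qed
    let ?r = "\<lambda>V a b. if a div s = b div s then factor_prod (s * n) L V $$ (a, b) - w else 0"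
    have summand: "\<bar>upper_prod (s * n) L l V $$ (a, i) * ?r V a b * factor_prod (s * n) (l - 1) V $$ (j, b)
      - upper_prod (s * n) L l V' $$ (a, i) * ?r V' a b * factor_prod (s * n) (l - 1) V' $$ (j, b)\<bar>
      \<le> 3 * R\<^sup>2 * (C * \<delta>)" if ab: "a < s * n" "b < s * n" for a b
    proof (rule triple_product_diff)
      note U = lip[of "L - l" l a i] and P = lip[of "l - 1" 0 j b] and F = lip[of L 0 a b]
      show "\<bar>upper_prod (s * n) L l V $$ (a, i)\<bar> \<le> R" "\<bar>upper_prod (s * n) L l V' $$ (a, i)\<bar> \<le> R"
        "\<bar>upper_prod (s * n) L l V $$ (a, i) - upper_prod (s * n) L l V' $$ (a, i)\<bar> \<le> C * \<delta>"
        using U l ab ij by (auto simp: d_def intro: order.trans[OF _ CR])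
      show "\<bar>factor_prod (s * n) (l - 1) V $$ (j, b)\<bar> \<le> R" "\<bar>factor_prod (s * n) (l - 1) V' $$ (j, b)\<bar> \<le> R"
        "\<bar>factor_prod (s * n) (l - 1) V $$ (j, b) - factor_prod (s * n) (l - 1) V' $$ (j, b)\<bar> \<le> C * \<delta>"
        using P l ab ij by (auto simp: d_def intro: order.trans[OF _ CR])
      have "\<bar>factor_prod (s * n) L V $$ (a, b)\<bar> \<le> C" "\<bar>factor_prod (s * n) L V' $$ (a, b)\<bar> \<le> C"
        "\<bar>factor_prod (s * n) L V $$ (a, b) - factor_prod (s * n) L V' $$ (a, b)\<bar> \<le> C * \<delta>"
        using F ab by (auto simp: d_def)
      then show "\<bar>?r V a b\<bar> \<le> R" "\<bar>?r V' a b\<bar> \<le> R" "\<bar>?r V a b - ?r V' a b\<bar> \<le> C * \<delta>"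
        using C0 \<delta> by (auto simp: R_def)
    qed
    have "\<bar>grad_entry w s n L V l i j - grad_entry w s n L V' l i j\<bar> \<le> d * (d * (3 * R\<^sup>2 * (C * \<delta>)))"
      unfolding grad_entry_def sum_subtractf[symmetric] d_def[symmetric]
      by (rule abs_sum_lessThan_le, rule abs_sum_lessThan_le, rule summand[folded d_def])
    then show "\<bar>grad_entry w s n L V l i j - grad_entry w s n L V' l i j\<bar>
        \<le> real d * (real d * (3 * R\<^sup>2 * C)) * \<delta>" by (simp add: mult_ac)
  qed
qed

section \<open>Reduction of the flow to scalar equations\<close>

text \<open>Representatives of the orbits of index pairs under the permutations that preserve the block
  partition. For \<open>s = 1\<close> the pair \<open>(0, 1)\<close> does not lie in a single block, but then the second case
  never occurs for \<open>i \<noteq> j\<close>.\<close>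

definition orbit_rep :: "nat \<Rightarrow> nat \<Rightarrow> nat \<Rightarrow> nat \<times> nat" where
  "orbit_rep s i j = (if i = j then (0, 0) else if i div s = j div s then (0, 1) else (0, s))"

lemma orbit_rep_less:
  assumes "s \<ge> 1" "n \<ge> 2"
  shows "fst (orbit_rep s i j) < s * n" "snd (orbit_rep s i j) < s * n"
proof -
  define d where "d = s * n"
  have "s * 2 \<le> d" unfolding d_def using assms by (intro mult_left_mono) auto
  then have "0 < d" "1 < d" "s < d" using assms by linarith+
  then show "fst (orbit_rep s i j) < s * n" "snd (orbit_rep s i j) < s * n"
    by (auto simp: orbit_rep_def simp flip: d_def)
qed

lemma bmat_orbit_rep:
  assumes "s \<ge> 1" "n \<ge> 2" "i < s * n" "j < s * n"
  shows "bmat s n x y z $$ (i, j) = bmat s n x y z $$ orbit_rep s i j"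
proof -
  have "s \<noteq> 1" if "i \<noteq> j" "i div s = j div s" using that by auto
  then have "1 div s = 0" if "i \<noteq> j" "i div s = j div s" using that assms by (intro div_less) auto
  then show ?thesis
    using assms orbit_rep_less[OF assms(1,2), of i j] by (auto simp: orbit_rep_def bmat_index)
qed

text \<open>The matrix is \<open>a - b\<close> times the identity plus \<open>b - c\<close> times
  the block-ones matrix plus \<open>c\<close> times the all-ones matrix. On the ranges of
  \<open>E1\<close>, \<open>E2\<close>, \<open>E3\<close> these three have the eigenvalues
  \<open>(1, 1, 1)\<close>, \<open>(s, s, 0)\<close> and \<open>(s n, 0, 0)\<close>.\<close>

lemma orbit_constant_eq_bmat:
  fixes a b c :: real
  assumes "s \<ge> 1" "n \<ge> 1"
  shows "mat (s * n) (s * n) (\<lambda>(i, j). if i = j then a else if i div s = j div s then b else c)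
    = bmat s n (a - b + s * (b - c) + s * n * c) (a - b + s * (b - c)) (a - b)"
  using assms by (intro eq_matI) (auto simp: bmat_def divide_simps)

text \<open>Replacing all factors by the matrix \<open>A\<close> with entries \<open>W t 1 $$ orbit_rep s i j\<close> is a linear
  projection whose range is invariant under the gradient field. Hence the squared distance \<open>E\<close>
  of \<open>W\<close> from its projection satisfies \<open>E' \<le> Q * E\<close> with \<open>E 0 = 0\<close>, so it vanishes. No
  solution of the reduced equations has to be constructed beforehand.\<close>

lemma flow_orbit_constant:
  fixes \<alpha> w :: real and W :: "real \<Rightarrow> nat \<Rightarrow> real mat"
  assumes sn: "s \<ge> 1" "n \<ge> 2" and L: "L \<ge> 1"
    and init: "\<forall>l\<in>{1..L}. W 0 l = init_mat (s * n) \<alpha> m"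
    and flow: "gradient_flow (s * n) L (phi w s n L) W"
    and T: "0 \<le> T" and l: "l \<in> {1..L}" and ij: "i < s * n" "j < s * n"
  shows "W T l $$ (i, j) = W T 1 $$ orbit_rep s i j"
proof -
  define d where "d = s * n"
  let ?\<rho> = "orbit_rep s"
  note rep = orbit_rep_less[OF sn, folded d_def]
  have carr: "W t l \<in> carrier_mat d d" if "0 \<le> t" "l \<in> {1..L}" for t l
    using flow that unfolding gradient_flow_def d_def by blast
  define g where "g t l ij = grad_entry w s n L (W t) l (fst ij) (snd ij)" for t l ij
  have der: "((\<lambda>\<tau>. W \<tau> l $$ ij) has_real_derivative - g t l ij) (at t within {0..})"
    if "0 \<le> t" "l \<in> {1..L}" "fst ij < d" "snd ij < d" for t l ij
  proof -
    have "((\<lambda>\<tau>. W \<tau> l $$ (fst ij, snd ij)) has_real_derivative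
        - partial_entry (phi w s n L) (W t) l (fst ij, snd ij)) (at t within {0..})"
      using flow that unfolding gradient_flow_def d_def by blast
    moreover have "partial_entry (phi w s n L) (W t) l (fst ij, snd ij) = g t l ij"
      unfolding g_def using carr that sn unfolding d_def by (intro partial_entry_phi) auto
    ultimately show ?thesis by simp
  qed
  define S where "S = {1..L} \<times> {..<d} \<times> {..<d}"
  have fS: "finite S" by (simp add: S_def)
  define v where "v t = (\<lambda>(l, i, j). W t l $$ (i, j) - W t 1 $$ ?\<rho> i j)" for t
  define E where "E t = (\<Sum>p\<in>S. (v t p)\<^sup>2)" for t
  define v' where "v' t = (\<lambda>(l, i, j). g t 1 (?\<rho> i j) - g t l (i, j))" for t
  have dv: "((\<lambda>t. v t p) has_real_derivative v' t p) (at t within {0..})" if t: "0 \<le> t" and pS: "p \<in> S" for t p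
  proof -
    obtain l i j where p: "p = (l, i, j)" "l \<in> {1..L}" "i < d" "j < d"
      using pS by (auto simp: S_def)
    have "((\<lambda>\<tau>. W \<tau> l $$ (i, j) - W \<tau> 1 $$ ?\<rho> i j) has_real_derivative - g t l (i, j) - - g t 1 (?\<rho> i j))
        (at t within {0..})"
      using t p rep L by (intro DERIV_diff der) auto
    then show ?thesis by (simp add: v_def v'_def p)
  qed
  have dE: "(E has_real_derivative (\<Sum>p\<in>S. 2 * v t p * v' t p)) (at t within {0..})" if "0 \<le> t" for t
    unfolding E_def[abs_def]
    by (auto intro!: derivative_eq_intros dv[OF that] sum.cong)
  \<comment> \<open>The gradient is polynomial, hence Lipschitz only on bounded sets; continuity on
    the compact interval up to \<open>T\<close> supplies such a set.\<close>
  obtain M where M: "0 \<le> M" "\<And>t l i j. 0 \<le> t \<Longrightarrow> t \<le> T \<Longrightarrow> l \<in> {1..L} \<Longrightarrow> i < d \<Longrightarrow> j < d \<Longrightarrow>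
      \<bar>W t l $$ (i, j)\<bar> \<le> M"
  proof -
    let ?N = "\<lambda>t. \<Sum>(l, i, j)\<in>S. \<bar>W t l $$ (i, j)\<bar>"
    have "continuous_on {0..T} (\<lambda>t. W t l $$ (i, j))" if "l \<in> {1..L}" "i < d" "j < d" for l i j
      using that
      by (intro continuous_on_subset[OF has_real_derivative_imp_continuous_on[OF der[of _ l "(i, j)"]]]) auto
    then have "continuous_on {0..T} ?N"
      by (intro continuous_on_sum) (auto simp: S_def intro!: continuous_intros)
    then have "bounded (?N ` {0..T})"
      by (intro compact_imp_bounded compact_continuous_image) auto
    then obtain M where "\<forall>x\<in>?N ` {0..T}. norm x \<le> M" unfolding bounded_iff ..
    then have M: "\<bar>?N t\<bar> \<le> M" if "0 \<le> t" "t \<le> T" for t using that by auto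
    show ?thesis
    proof (rule that[of M])
      show "0 \<le> M" using M[of 0] T by linarith
      fix t l i j assume *: "0 \<le> t" "t \<le> T" "l \<in> {1..L}" "i < d" "j < d"
      have "(case (l, i, j) of (l, i, j) \<Rightarrow> \<bar>W t l $$ (i, j)\<bar>) \<le> ?N t"
        by (rule member_le_sum) (use * in \<open>auto simp: S_def\<close>)
      then show "\<bar>W t l $$ (i, j)\<bar> \<le> M" using M[OF *(1,2)] by simp
    qed
  qed
  have "s * n \<ge> 1" using sn by simp
  obtain K where K: "0 \<le> K" "\<And>V V' \<delta> l i j.
    (\<And>q. q \<in> {1..L} \<Longrightarrow> V q \<in> carrier_mat d d) \<Longrightarrow>
    (\<And>q. q \<in> {1..L} \<Longrightarrow> V' q \<in> carrier_mat d d) \<Longrightarrow>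
    (\<And>q i j. q \<in> {1..L} \<Longrightarrow> i < d \<Longrightarrow> j < d \<Longrightarrow> \<bar>V q $$ (i, j)\<bar> \<le> M) \<Longrightarrow>
    (\<And>q i j. q \<in> {1..L} \<Longrightarrow> i < d \<Longrightarrow> j < d \<Longrightarrow> \<bar>V' q $$ (i, j)\<bar> \<le> M) \<Longrightarrow>
    (\<And>q i j. q \<in> {1..L} \<Longrightarrow> i < d \<Longrightarrow> j < d \<Longrightarrow> \<bar>V q $$ (i, j) - V' q $$ (i, j)\<bar> \<le> \<delta>) \<Longrightarrow>
    0 \<le> \<delta> \<Longrightarrow> l \<in> {1..L} \<Longrightarrow> i < d \<Longrightarrow> j < d \<Longrightarrow>
    \<bar>grad_entry w s n L V l i j - grad_entry w s n L V' l i j\<bar> \<le> K * \<delta>"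
    using grad_entry_lipschitz[OF M(1) \<open>s * n \<ge> 1\<close>, of L w] unfolding d_def by blast
  have v_le: "\<bar>v t p\<bar> \<le> sqrt (E t)" if "p \<in> S" for t p
  proof -
    have "(v t p)\<^sup>2 \<le> E t" unfolding E_def using that fS by (intro member_le_sum) auto
    then show ?thesis by (simp add: real_le_rsqrt)
  qed
  have v'_le: "\<bar>v' t p\<bar> \<le> 2 * K * sqrt (E t)" if t: "0 \<le> t" "t \<le> T" and p: "p \<in> S" for t p
  proof -
    obtain l i j where p: "p = (l, i, j)" "l \<in> {1..L}" "i < d" "j < d"
      using p by (auto simp: S_def)
    define a b c where "a = W t 1 $$ (0, 0)" and "b = W t 1 $$ (0, 1)" and "c = W t 1 $$ (0, s)"
    define A where "A = bmat s n (a - b + s * (b - c) + s * n * c) (a - b + s * (b - c)) (a - b)"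
    have A: "A $$ (i, j) = W t 1 $$ ?\<rho> i j" if "i < d" "j < d" for i j
    proof -
      have "A = mat d d (\<lambda>(i, j). if i = j then a else if i div s = j div s then b else c)"
        using orbit_constant_eq_bmat[of s n a b c] sn by (simp add: A_def d_def)
      then show ?thesis using that by (simp add: orbit_rep_def a_def b_def c_def)
    qed
    have lip: "\<bar>grad_entry w s n L (W t) l i j - grad_entry w s n L (\<lambda>_. A) l i j\<bar> \<le> K * sqrt (E t)"
      if lij: "l \<in> {1..L}" "i < d" "j < d" for l i j
    proof (rule K(2)[OF _ _ _ _ _ _ lij])
      show "W t q \<in> carrier_mat d d" if "q \<in> {1..L}" for q using carr[OF t(1) that] .
      show "A \<in> carrier_mat d d" by (simp add: A_def d_def)
      show "\<bar>W t q $$ (i, j)\<bar> \<le> M" if "q \<in> {1..L}" "i < d" "j < d" for q i j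
        using M(2)[OF t that] .
      show "\<bar>A $$ (i, j)\<bar> \<le> M" if "i < d" "j < d" for i j
        using M(2)[OF t, of 1 "fst (?\<rho> i j)" "snd (?\<rho> i j)"] A[OF that] rep L by simp
      show "\<bar>W t q $$ (i, j) - A $$ (i, j)\<bar> \<le> sqrt (E t)" if "q \<in> {1..L}" "i < d" "j < d" for q i j
        using v_le[of "(q, i, j)" t] that A by (simp add: v_def S_def)
      show "0 \<le> sqrt (E t)" by (simp add: E_def sum_nonneg)
    qed
    \<comment> \<open>At the projected family the gradient is one block-symmetric matrix for all
      \<open>l\<close>, so it agrees at a pair and at its representative. Both terms of
      \<open>v'\<close> can thus be compared with the same number.\<close>
    have "\<exists>x y z. \<forall>l i j. l \<in> {1..L} \<longrightarrow> i < d \<longrightarrow> j < d \<longrightarrow>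
        grad_entry w s n L (\<lambda>_. A) l i j = bmat s n x y z $$ (i, j)"
      unfolding A_def d_def
      by (intro exI allI impI, rule grad_entry_bmat[OF _ _ _ _ _ refl]) (use sn in auto)
    then obtain x y z where gA: "\<And>l i j. l \<in> {1..L} \<Longrightarrow> i < d \<Longrightarrow> j < d \<Longrightarrow>
        grad_entry w s n L (\<lambda>_. A) l i j = bmat s n x y z $$ (i, j)" by blast
    have "grad_entry w s n L (\<lambda>_. A) l i j
        = grad_entry w s n L (\<lambda>_. A) 1 (fst (?\<rho> i j)) (snd (?\<rho> i j))"
      using gA[OF p(2-4)] gA[OF _ rep, of 1 i j i j] L bmat_orbit_rep[OF sn p(3,4)[unfolded d_def], of x y z]
      by simp
    moreover have "\<bar>g t l (i, j) - grad_entry w s n L (\<lambda>_. A) l i j\<bar> \<le> K * sqrt (E t)"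
      using lip[OF p(2-4)] by (simp add: g_def)
    moreover have "\<bar>g t 1 (?\<rho> i j) - grad_entry w s n L (\<lambda>_. A) 1 (fst (?\<rho> i j)) (snd (?\<rho> i j))\<bar>
        \<le> K * sqrt (E t)"
      using lip[OF _ rep, of 1 i j i j] L by (simp add: g_def)
    ultimately show ?thesis by (simp add: v'_def p)
  qed
  \<comment> \<open>Each of the \<open>card S\<close> squares contributes 2 from the derivative of a
    square times \<open>2 * K\<close> from the two Lipschitz estimates in \<open>v'\<close>.\<close>
  define Q where "Q = card S * (4 * K)"
  have E_growth: "(\<Sum>p\<in>S. 2 * v t p * v' t p) \<le> Q * E t" if t: "0 \<le> t" "t \<le> T" for t
  proof -
    have E0: "0 \<le> E t" by (simp add: E_def sum_nonneg)
    have "(\<Sum>p\<in>S. 2 * v t p * v' t p) \<le> (\<Sum>p\<in>S. 4 * K * E t)"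
    proof (rule sum_mono)
      fix p assume p: "p \<in> S"
      have "v t p * v' t p \<le> \<bar>v t p\<bar> * \<bar>v' t p\<bar>" by (simp flip: abs_mult)
      also have "\<dots> \<le> sqrt (E t) * (2 * K * sqrt (E t))"
        using v_le[OF p] v'_le[OF t p] E0 by (intro mult_mono) auto
      also have "\<dots> = 2 * K * E t" using E0 by simp
      finally show "2 * v t p * v' t p \<le> 4 * K * E t" by (simp add: mult_ac)
    qed
    then show ?thesis by (simp add: Q_def)
  qed
  have "E T * exp (- Q * T) \<le> E 0 * exp (- Q * 0)"
  proof (rule nonincreasing_on[OF _ T])
    fix t assume t: "0 \<le> t" "t \<le> T"
    show "((\<lambda>t. E t * exp (- Q * t)) has_real_derivative
        ((\<Sum>p\<in>S. 2 * v t p * v' t p) - Q * E t) * exp (- Q * t)) (at t within {0..})"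
      by (auto intro!: derivative_eq_intros dE[OF t(1)] simp: algebra_simps)
    show "((\<Sum>p\<in>S. 2 * v t p * v' t p) - Q * E t) * exp (- Q * t) \<le> 0"
      by (rule mult_nonpos_nonneg) (use E_growth[OF t] in auto)
  qed simp
  also have "E 0 = 0"
  proof -
    have "v 0 p = 0" if p: "p \<in> S" for p
    proof -
      obtain l i j where p: "p = (l, i, j)" "l \<in> {1..L}" "i < d" "j < d"
        using p by (auto simp: S_def)
      have "fst (?\<rho> i j) = snd (?\<rho> i j) \<longleftrightarrow> i = j" using sn by (auto simp: orbit_rep_def)
      moreover have "init_mat d \<alpha> m $$ (i, j)
          = (if i = j then \<alpha> else real_of_ereal (ereal \<alpha> / m))" if "i < d" "j < d" for i j
        using that by (simp add: init_mat_def)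
      ultimately have "init_mat d \<alpha> m $$ (i, j) = init_mat d \<alpha> m $$ ?\<rho> i j"
        using p rep[of i j] by (metis prod.collapse)
      then show ?thesis using init p L by (simp add: v_def d_def)
    qed
    then show ?thesis by (simp add: E_def)
  qed
  finally have "E T \<le> 0" by (simp add: mult_le_0_iff)
  then have "sqrt (E T) \<le> 0" by simp
  moreover have "\<bar>v T (l, i, j)\<bar> \<le> sqrt (E T)"
    using l ij by (intro v_le) (simp add: S_def d_def)
  ultimately have "\<bar>v T (l, i, j)\<bar> \<le> 0" by linarith
  then show ?thesis by (simp add: v_def)
qed

lemma flow_reduction:
  fixes \<alpha> w :: real and W :: "real \<Rightarrow> nat \<Rightarrow> real mat" and m :: ereal
  assumes sn: "s \<ge> 1" "n \<ge> 2" and L: "L \<ge> 1"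
    and init: "\<forall>l\<in>{1..L}. W 0 l = init_mat (s * n) \<alpha> m"
    and flow: "gradient_flow (s * n) L (phi w s n L) W"
  defines "\<beta> \<equiv> real_of_ereal (ereal \<alpha> / m)"
  shows "\<exists>x y z r.
    (\<forall>t. r t = (x t ^ L - y t ^ L) / n + y t ^ L - s * w) \<and>
    (\<forall>t\<ge>0. \<forall>l\<in>{1..L}. W t l = bmat s n (x t) (y t) (z t)) \<and>
    (\<forall>t\<ge>0. (x has_real_derivative - (r t * x t ^ (L - 1))) (at t within {0..})) \<and>
    (\<forall>t\<ge>0. (y has_real_derivative - (r t * y t ^ (L - 1))) (at t within {0..})) \<and>
    (s \<ge> 2 \<longrightarrow> (\<forall>t\<ge>0. (z has_real_derivative - (z t ^ (2 * L - 1))) (at t within {0..}))) \<and>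
    x 0 = \<alpha> + (real (s * n) - 1) * \<beta> \<and> y 0 = \<alpha> - \<beta> \<and> z 0 = \<alpha> - \<beta>"
proof -
  define d where "d = s * n"
  define a b c where "a t = W t 1 $$ (0, 0)" and "b t = W t 1 $$ (0, 1)" and "c t = W t 1 $$ (0, s)" for t
  \<comment> \<open>For \<open>s = 1\<close> the entries \<open>b\<close> and \<open>c\<close>
    coincide and \<open>z\<close> equals \<open>y\<close>, so \<open>z\<close> obeys its own decay
    equation only for \<open>s \<ge> 2\<close>.\<close>
  define x y z where "x t = a t - b t + s * (b t - c t) + s * n * c t"
    and "y t = a t - b t + s * (b t - c t)" and "z t = a t - b t" for t
  define r where "r t = (x t ^ L - y t ^ L) / n + y t ^ L - s * w" for t
  have "s * 2 \<le> d" unfolding d_def using sn by (intro mult_left_mono) auto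
  then have d: "0 < d" "1 < d" "s < d" using sn by linarith+
  have W: "W t l = bmat s n (x t) (y t) (z t)" if t: "0 \<le> t" and l: "l \<in> {1..L}" for t l
  proof -
    have "W t l \<in> carrier_mat d d" using flow t l unfolding gradient_flow_def d_def by blast
    moreover have "W t l $$ (i, j) = (if i = j then a t else if i div s = j div s then b t else c t)"
      if "i < d" "j < d" for i j
      using flow_orbit_constant[OF sn L init flow t l, of i j] that
      by (auto simp: d_def orbit_rep_def a_def b_def c_def)
    ultimately have "W t l = mat d d (\<lambda>(i, j). if i = j then a t else if i div s = j div s then b t else c t)"
      by (intro eq_matI) auto
    then show ?thesis
      using orbit_constant_eq_bmat[of s n "a t" "b t" "c t"] sn by (simp add: d_def x_def y_def z_def)
  qed
  define G where "G t = bmat s n (r t * x t ^ (L - 1)) (r t * y t ^ (L - 1)) (z t ^ L * z t ^ (L - 1))" for t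
  have der: "((\<lambda>\<tau>. W \<tau> 1 $$ (i, j)) has_real_derivative - G t $$ (i, j)) (at t within {0..})"
    if t: "0 \<le> t" and ij: "i < d" "j < d" for t i j
  proof -
    have "((\<lambda>\<tau>. W \<tau> 1 $$ (i, j)) has_real_derivative
        - partial_entry (phi w s n L) (W t) 1 (i, j)) (at t within {0..})"
      using flow t ij L unfolding gradient_flow_def d_def by auto
    also have "partial_entry (phi w s n L) (W t) 1 (i, j) = grad_entry w s n L (W t) 1 i j"
      using W[OF t] ij sn L by (intro partial_entry_phi) (auto simp: d_def)
    also have "\<dots> = grad_entry w s n L (\<lambda>_. bmat s n (x t) (y t) (z t)) 1 i j"
      using W[OF t] L by (intro grad_entry_cong) auto
    also have "\<dots> = G t $$ (i, j)"
      unfolding G_def using sn L ij by (intro grad_entry_bmat) (auto simp: d_def r_def)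
    finally show ?thesis .
  qed
  have da: "(a has_real_derivative - G t $$ (0, 0)) (at t within {0..})"
    and db: "(b has_real_derivative - G t $$ (0, 1)) (at t within {0..})"
    and dc: "(c has_real_derivative - G t $$ (0, s)) (at t within {0..})" if "0 \<le> t" for t
    unfolding a_def[abs_def] b_def[abs_def] c_def[abs_def] using der[OF that] d by auto
  \<comment> \<open>For \<open>s = 1\<close> the indices 0 and 1 lie in different blocks, whence the
    case distinction in \<open>G1\<close>.\<close>
  have G0: "G t $$ (0, 0) = (r t * x t ^ (L - 1) - r t * y t ^ (L - 1)) / d
       + (r t * y t ^ (L - 1) - z t ^ L * z t ^ (L - 1)) / s + z t ^ L * z t ^ (L - 1)"
    and G1: "G t $$ (0, 1) = (r t * x t ^ (L - 1) - r t * y t ^ (L - 1)) / d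
       + (if s = 1 then 0 else (r t * y t ^ (L - 1) - z t ^ L * z t ^ (L - 1)) / s)"
    and Gs: "G t $$ (0, s) = (r t * x t ^ (L - 1) - r t * y t ^ (L - 1)) / d" for t
    unfolding G_def using d sn by (auto simp: bmat_index simp flip: d_def)
  have dn: "real d = s * n" by (simp add: d_def)
  have ds: "real d > 0" "real s > 0" using d sn by simp_all
  show ?thesis
  proof (rule exI[of _ x], rule exI[of _ y], rule exI[of _ z], rule exI[of _ r], intro conjI allI ballI impI)
    show "r t = (x t ^ L - y t ^ L) / n + y t ^ L - s * w" for t by (rule r_def)
    show "W t l = bmat s n (x t) (y t) (z t)" if "0 \<le> t" "l \<in> {1..L}" for t l using W that .
    fix t :: real assume t: "0 \<le> t"
    note D = da[OF t] db[OF t] dc[OF t]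
    have "(y has_real_derivative - G t $$ (0, 0) - - G t $$ (0, 1) + s * (- G t $$ (0, 1) - - G t $$ (0, s)))
        (at t within {0..})"
      unfolding y_def[abs_def] by (intro DERIV_add DERIV_diff DERIV_cmult D)
    then show "(y has_real_derivative - (r t * y t ^ (L - 1))) (at t within {0..})"
      by (rule DERIV_cong) (unfold G0 G1 Gs, use ds sn in \<open>auto simp: field_simps\<close>)
    have "(x has_real_derivative - G t $$ (0, 0) - - G t $$ (0, 1) + s * (- G t $$ (0, 1) - - G t $$ (0, s))
        + s * n * - G t $$ (0, s)) (at t within {0..})"
      unfolding x_def[abs_def] by (intro DERIV_add DERIV_diff DERIV_cmult D)
    then show "(x has_real_derivative - (r t * x t ^ (L - 1))) (at t within {0..})"
      unfolding dn[symmetric]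
      by (rule DERIV_cong) (unfold G0 G1 Gs, use ds sn in \<open>auto simp: field_simps\<close>)
    assume s2: "s \<ge> 2"
    have "(z has_real_derivative - G t $$ (0, 0) - - G t $$ (0, 1)) (at t within {0..})"
      unfolding z_def[abs_def] by (intro DERIV_diff D)
    then have "(z has_real_derivative - (z t ^ L * z t ^ (L - 1))) (at t within {0..})"
      by (rule DERIV_cong) (unfold G0 G1, use s2 in auto)
    also have "z t ^ L * z t ^ (L - 1) = z t ^ (2 * L - 1)"
      using L by (simp add: mult_2 flip: power_add)
    finally show "(z has_real_derivative - (z t ^ (2 * L - 1))) (at t within {0..})" .
  next
    have "a 0 = \<alpha>" "b 0 = \<beta>" "c 0 = \<beta>"
      using init L d sn by (auto simp: a_def b_def c_def init_mat_def \<beta>_def simp flip: d_def)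
    then show "x 0 = \<alpha> + (real (s * n) - 1) * \<beta>" "y 0 = \<alpha> - \<beta>" "z 0 = \<alpha> - \<beta>"
      by (auto simp: x_def y_def z_def algebra_simps)
  qed
qed

section \<open>The limit of the product\<close>

theorem theorem3p3:
  fixes \<alpha> w :: real and m :: ereal and n s L d :: nat
    and W :: "real \<Rightarrow> nat \<Rightarrow> real mat"
  assumes "\<alpha> > 0" and "1 < m" and "n \<ge> 2" and "s \<ge> 1" and "L \<ge> 2"
    and "d = s * n" and "w > 0"
    and init: "\<forall>l\<in>{1..L}. W 0 l = init_mat d \<alpha> m"
    and flow: "gradient_flow d L (phi w s n L) W"
  shows "\<exists>Winf \<in> carrier_mat d d.
    mat_tendsto (\<lambda>t. factor_prod d L (W t)) Winf \<and>
    loss w (Omega_block s n) Winf = 0 \<and>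
    (\<forall>j\<in>{n<..d}. sing_val Winf j = 0) \<and>
    (\<forall>i\<in>{2..n}.
      (L = 2 \<and> m < \<infinity> \<longrightarrow>
        (let \<mu> = real_of_ereal m in
          sing_val Winf 1 = w * d * (\<mu> + d - 1)\<^sup>2 / ((\<mu> + d - 1)\<^sup>2 + (real n - 1) * (\<mu> - 1)\<^sup>2) \<and>
          sing_val Winf i = w * d * (\<mu> - 1)\<^sup>2 / ((\<mu> + d - 1)\<^sup>2 + (real n - 1) * (\<mu> - 1)\<^sup>2))) \<and>
      (L \<ge> 3 \<and> m < \<infinity> \<longrightarrow>
        (let \<mu> = real_of_ereal m; p = (2 - real L) / real L;
             \<sigma>\<^sub>1 = sing_val Winf 1; \<sigma>\<^sub>i = sing_val Winf i in
          \<sigma>\<^sub>1 > 0 \<and> w * d - \<sigma>\<^sub>1 > 0 \<and> w * d - (real n - 1) * \<sigma>\<^sub>i > 0 \<and> \<sigma>\<^sub>i > 0 \<and>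
          \<sigma>\<^sub>1 powr p - ((w * d - \<sigma>\<^sub>1) / (real n - 1)) powr p = C_const \<alpha> \<mu> L d \<and>
          (w * d - (real n - 1) * \<sigma>\<^sub>i) powr p - \<sigma>\<^sub>i powr p = C_const \<alpha> \<mu> L d)) \<and>
      (L \<ge> 3 \<and> m = \<infinity> \<longrightarrow>
        sing_val Winf 1 = s * w \<and> sing_val Winf i = s * w))"
proof -
  note L = \<open>L \<ge> 2\<close> and n = \<open>n \<ge> 2\<close> and s = \<open>s \<ge> 1\<close> and w = \<open>w > 0\<close> and d = \<open>d = s * n\<close>
  \<comment> \<open>The off-diagonal initial entry, 0 if \<open>m = \<infinity>\<close>; the bounds
    \<open>0 \<le> \<beta> < \<alpha>\<close> let finite and infinite \<open>m\<close> share the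
    convergence argument.\<close>
  define \<beta> where "\<beta> = real_of_ereal (ereal \<alpha> / m)"
  have \<beta>: "0 \<le> \<beta>" "\<beta> < \<alpha>"
    using \<open>\<alpha> > 0\<close> \<open>1 < m\<close> by (cases m; simp add: \<beta>_def field_simps)+
  have L1: "L \<ge> 1" using L by simp
  obtain x y z r where red: "\<forall>t. r t = (x t ^ L - y t ^ L) / n + y t ^ L - s * w"
    "\<forall>t\<ge>0. \<forall>l\<in>{1..L}. W t l = bmat s n (x t) (y t) (z t)"
    "\<forall>t\<ge>0. (x has_real_derivative - (r t * x t ^ (L - 1))) (at t within {0..})"
    "\<forall>t\<ge>0. (y has_real_derivative - (r t * y t ^ (L - 1))) (at t within {0..})"
    "s \<ge> 2 \<longrightarrow> (\<forall>t\<ge>0. (z has_real_derivative - (z t ^ (2 * L - 1))) (at t within {0..}))"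
    and x0: "x 0 = \<alpha> + (real (s * n) - 1) * \<beta>" and y0: "y 0 = \<alpha> - \<beta>" and z0: "z 0 = \<alpha> - \<beta>"
    using flow_reduction[OF s n L1 init[unfolded d] flow[unfolded d]] unfolding \<beta>_def by blast
  have W: "W t l = bmat s n (x t) (y t) (z t)" if "0 \<le> t" "l \<in> {1..L}" for t l
    using red(2) that by blast
  have dz: "(z has_real_derivative - (z t ^ (2 * L - 1))) (at t within {0..})" if "s \<ge> 2" "0 \<le> t" for t
    using red(5) that by blast
  have "y 0 \<le> x 0" using \<beta> n s by (simp add: x0 y0 algebra_simps)
  interpret reduced_flow x y n s L w r
  proof unfold_locales
    show "0 < y 0" using \<beta> y0 by simp
  qed (use n s L w red \<open>y 0 \<le> x 0\<close> in blast)+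
  obtain a b where lim: "(x \<longlongrightarrow> a) at_top" "(y \<longlongrightarrow> b) at_top" and ab: "0 < b" "b \<le> a"
    and sum: "a ^ L + (real n - 1) * b ^ L = n * s * w"
    and ratio: "L = 2 \<longrightarrow> a * y 0 = b * x 0"
    and pow: "inverse (a ^ (L - 2)) - inverse (b ^ (L - 2)) = inverse (x 0 ^ (L - 2)) - inverse (y 0 ^ (L - 2))"
    using limits by blast
  define Winf where "Winf = bmat s n (a ^ L) (b ^ L) 0"
  have bL: "0 < b ^ L" "b ^ L \<le> a ^ L" using ab by (auto intro: power_mono)
  have n1: "n \<ge> 1" using n by simp
  have sv: "sing_val Winf 1 = a ^ L" "\<And>i. i \<in> {2..n} \<Longrightarrow> sing_val Winf i = b ^ L"
    "\<And>j. j \<in> {n<..d} \<Longrightarrow> sing_val Winf j = 0"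
    unfolding Winf_def d using sing_val_bmat[OF s n1 bL(2)] bL(1) by auto
  have F: "factor_prod d L (W t) = bmat s n (x t ^ L) (y t ^ L) (z t ^ L)" if "0 \<le> t" for t
    using factor_prod_cong[of L "W t" "\<lambda>_. bmat s n (x t) (y t) (z t)" d] W[OF that]
      factor_prod_const_bmat[OF s n1] by (simp add: d)
  have "mat_tendsto (\<lambda>t. factor_prod d L (W t)) Winf"
    unfolding mat_tendsto_def
  proof (intro allI impI)
    fix i j assume "i < dim_row Winf" "j < dim_col Winf"
    then have ij: "i < s * n" "j < s * n" by (auto simp: Winf_def bmat_def)
    \<comment> \<open>The entry of \<open>E3\<close> at \<open>(i, j)\<close>. For
      \<open>s = 1\<close> it vanishes, which disposes of \<open>z\<close> although it then does not
      decay.\<close>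
    define \<kappa> where "\<kappa> = (if i = j then 1 else 0) - (if i div s = j div s then 1 / s else (0::real))"
    have e: "bmat s n u v q $$ (i, j) = (u - v) / (s * n) + (if i div s = j div s then v / s else 0) + q * \<kappa>"
      for u v q using ij by (auto simp: bmat_index \<kappa>_def diff_divide_distrib right_diff_distrib)
    have z: "((\<lambda>t. z t ^ L * \<kappa>) \<longlongrightarrow> 0) at_top"
    proof (cases "s \<ge> 2")
      case True
      have "(z \<longlongrightarrow> 0) at_top"
        using L z0 \<beta> by (intro power_flow_decay[OF dz[OF True]]) auto
      then have "((\<lambda>t. z t ^ L * \<kappa>) \<longlongrightarrow> 0 ^ L * \<kappa>) at_top" by (intro tendsto_intros)
      then show ?thesis using L by (simp add: zero_power)
    next
      case False
      then have "s = 1" using s by simp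
      then have "\<kappa> = 0" by (simp add: \<kappa>_def)
      then show ?thesis by simp
    qed
    have xy: "((\<lambda>t. (x t ^ L - y t ^ L) / (s * n)) \<longlongrightarrow> (a ^ L - b ^ L) / (s * n)) at_top"
      using s n by (intro tendsto_intros lim) auto
    have yy: "((\<lambda>t. if i div s = j div s then y t ^ L / s else 0) \<longlongrightarrow> (if i div s = j div s then b ^ L / s else 0)) at_top"
      using s by (auto intro!: tendsto_intros lim)
    have "((\<lambda>t. bmat s n (x t ^ L) (y t ^ L) (z t ^ L) $$ (i, j)) \<longlongrightarrow> Winf $$ (i, j)) at_top"
      unfolding Winf_def e using tendsto_add[OF tendsto_add[OF xy yy] z] by simp
    moreover have "\<forall>\<^sub>F t in at_top. bmat s n (x t ^ L) (y t ^ L) (z t ^ L) $$ (i, j) = factor_prod d L (W t) $$ (i, j)"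
      using F by (auto intro!: eventually_at_top_linorderI[of 0])
    ultimately show "((\<lambda>t. factor_prod d L (W t) $$ (i, j)) \<longlongrightarrow> Winf $$ (i, j)) at_top"
      by (rule Lim_transform_eventually)
  qed
  moreover have "loss w (Omega_block s n) Winf = 0"
  proof -
    have "(a ^ L - b ^ L) / (s * n) + b ^ L / s = (a ^ L + (real n - 1) * b ^ L) / (s * n)"
      using s n by (simp add: field_simps)
    also have "\<dots> = w" using s n by (simp add: sum)
    finally have "Winf $$ ij = w" if "ij \<in> Omega_block s n" for ij
      using that by (auto simp: Omega_block_eq[OF s] Winf_def bmat_index)
    then show ?thesis by (simp add: loss_def)
  qed
  moreover have "sing_val Winf 1 = w * d * (\<mu> + d - 1)\<^sup>2 / ((\<mu> + d - 1)\<^sup>2 + (real n - 1) * (\<mu> - 1)\<^sup>2) \<and>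
      sing_val Winf i = w * d * (\<mu> - 1)\<^sup>2 / ((\<mu> + d - 1)\<^sup>2 + (real n - 1) * (\<mu> - 1)\<^sup>2)"
    if "L = 2" "m = ereal \<mu>" "i \<in> {2..n}" for i \<mu>
  proof -
    have mu: "\<mu> > 1" using \<open>1 < m\<close> that by simp
    have \<beta>': "\<beta> = \<alpha> / \<mu>" using mu by (simp add: \<beta>_def that)
    \<comment> \<open>The initial values \<open>x 0\<close> and \<open>y 0\<close> without their
      common factor \<open>\<alpha> / \<mu>\<close>. Only their ratio enters for
      \<open>L = 2\<close>, so \<open>\<alpha>\<close> cancels.\<close>
    define u v where "u = \<mu> + d - 1" and "v = \<mu> - 1"
    have uv: "u > 0" "v > 0" using mu by (auto simp: u_def v_def)
    have "x 0 = \<alpha> / \<mu> * u" "y 0 = \<alpha> / \<mu> * v"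
      using mu by (simp_all add: x0 y0 \<beta>' u_def v_def d field_simps)
    then have "\<alpha> / \<mu> * (a * v) = \<alpha> / \<mu> * (b * u)" using ratio that(1) by (simp add: mult_ac)
    then have av: "a * v = b * u" using \<open>\<alpha> > 0\<close> mu by simp
    then have b: "b = a * v / u" using uv by (simp add: field_simps)
    have D: "u\<^sup>2 + (real n - 1) * v\<^sup>2 > 0" using uv n by (intro add_pos_nonneg) auto
    have "a\<^sup>2 * (u\<^sup>2 + (real n - 1) * v\<^sup>2) = w * d * u\<^sup>2"
    proof -
      have "a\<^sup>2 * (u\<^sup>2 + (real n - 1) * v\<^sup>2) = (a\<^sup>2 + (real n - 1) * b\<^sup>2) * u\<^sup>2"
        using uv by (simp add: b field_simps)
      then show ?thesis using sum that(1) d by (simp add: mult_ac)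
    qed
    then have a2: "a\<^sup>2 = w * d * u\<^sup>2 / (u\<^sup>2 + (real n - 1) * v\<^sup>2)" using D by (simp add: field_simps)
    have "b\<^sup>2 = a\<^sup>2 * v\<^sup>2 / u\<^sup>2" by (simp add: b power_mult_distrib power_divide)
    also have "\<dots> = w * d * v\<^sup>2 / (u\<^sup>2 + (real n - 1) * v\<^sup>2)" using uv unfolding a2 by simp
    finally show ?thesis using a2 sv that(1,3) unfolding u_def v_def by simp
  qed
  \<comment> \<open>The positivity claims ensure that every \<open>powr\<close> below has a positive
    base and so is the genuine real power.\<close>
  moreover have "\<sigma>\<^sub>1 > 0 \<and> w * d - \<sigma>\<^sub>1 > 0 \<and> w * d - (real n - 1) * \<sigma>\<^sub>i > 0 \<and> \<sigma>\<^sub>i > 0 \<and>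
      \<sigma>\<^sub>1 powr p - ((w * d - \<sigma>\<^sub>1) / (real n - 1)) powr p = C_const \<alpha> \<mu> L d \<and>
      (w * d - (real n - 1) * \<sigma>\<^sub>i) powr p - \<sigma>\<^sub>i powr p = C_const \<alpha> \<mu> L d"
    if L3: "L \<ge> 3" and m: "m = ereal \<mu>" and i: "i \<in> {2..n}"
      and p: "p = (2 - real L) / real L" and \<sigma>: "\<sigma>\<^sub>1 = sing_val Winf 1" "\<sigma>\<^sub>i = sing_val Winf i"
    for i \<mu> p \<sigma>\<^sub>1 \<sigma>\<^sub>i
  proof -
    have mu: "\<mu> > 1" using \<open>1 < m\<close> m by simp
    have \<beta>': "\<beta> = \<alpha> / \<mu>" using mu by (simp add: \<beta>_def m)
    have s1: "\<sigma>\<^sub>1 = a ^ L" "\<sigma>\<^sub>i = b ^ L" using \<sigma> sv i by auto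
    have s2: "w * d - \<sigma>\<^sub>1 = (real n - 1) * b ^ L" "w * d - (real n - 1) * \<sigma>\<^sub>i = a ^ L"
      using sum unfolding s1 d by (simp_all add: algebra_simps)
    have s3: "(w * d - \<sigma>\<^sub>1) / (real n - 1) = b ^ L" unfolding s2 using n by simp
    \<comment> \<open>The exponent \<open>(2 - L) / L\<close> on a singular value
      \<open>q ^ L\<close> is the exponent \<open>2 - L\<close> on \<open>q\<close>, which is the
      form of the conservation law.\<close>
    have pw: "(q ^ L) powr p = inverse (q ^ (L - 2))" if "q > 0" for q :: real
    proof -
      have "(q ^ L) powr p = q powr (real L * p)"
        using that by (simp add: powr_powr flip: powr_realpow)
      also have "real L * p = - real (L - 2)" using L3 by (simp add: p)
      also have "q powr - real (L - 2) = inverse (q ^ (L - 2))"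
        using that by (simp only: powr_minus powr_realpow)
      finally show ?thesis .
    qed
    have pi: "q powi (2 - int L) = inverse (q ^ (L - 2))" for q :: real
    proof -
      have "2 - int L = - int (L - 2)" using L3 by simp
      then show ?thesis by (simp only: power_int_minus power_int_of_nat)
    qed
    have "C_const \<alpha> \<mu> L d = (\<alpha> / \<mu> * (\<mu> + d - 1)) powi (2 - int L) - (\<alpha> / \<mu> * (\<mu> - 1)) powi (2 - int L)"
      unfolding C_const_def power_int_mult_distrib by (rule right_diff_distrib)
    also have "\<alpha> / \<mu> * (\<mu> + d - 1) = x 0" using mu by (simp add: x0 \<beta>' d field_simps)
    also have "\<alpha> / \<mu> * (\<mu> - 1) = y 0" using mu by (simp add: y0 \<beta>' field_simps)
    finally have "C_const \<alpha> \<mu> L d = inverse (a ^ (L - 2)) - inverse (b ^ (L - 2))"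
      unfolding pi using pow by simp
    then have C: "(a ^ L) powr p - (b ^ L) powr p = C_const \<alpha> \<mu> L d" using ab by (simp add: pw)
    then show ?thesis unfolding s3 s2 unfolding s1 using ab n C by simp
  qed
  moreover have "sing_val Winf 1 = s * w \<and> sing_val Winf i = s * w"
    if L3: "L \<ge> 3" and m: "m = \<infinity>" and i: "i \<in> {2..n}" for i
  proof -
    \<comment> \<open>The factors start at a multiple of the identity, so \<open>x 0 = y 0\<close>;
      the conserved quantity is 0 and forces \<open>a = b\<close>.\<close>
    have "\<beta> = 0" by (simp add: \<beta>_def m)
    then have "inverse (a ^ (L - 2)) = inverse (b ^ (L - 2))" using pow by (simp add: x0 y0)
    then have "a ^ (L - 2) = b ^ (L - 2)" by simp
    moreover have "L - 2 > 0" using L3 by simp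
    ultimately have "a = b" using ab by (intro power_eq_imp_eq_base[of a "L - 2" b]) auto
    then have "real n * a ^ L = real n * (s * w)" using sum by (simp add: algebra_simps)
    then have "a ^ L = s * w" using n by simp
    then show ?thesis using sv i \<open>a = b\<close> by simp
  qed
  moreover have "Winf \<in> carrier_mat d d" by (simp add: Winf_def d)
  moreover have "m = ereal (real_of_ereal m)" if "m < \<infinity>" using that \<open>1 < m\<close> by (cases m) auto
  ultimately show ?thesis
    using sv(3) unfolding Let_def by (intro bexI[of _ Winf] conjI ballI impI) blast+
qed

end
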